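(* Let $G=(V,E)$ be an unweighted undirected graph on $n$ vertices, let $k$ be a positive integer and let $\epsilon>0$. Then there exists a path-reporting distance oracle for $G$ with space $O(kn/\epsilon)$ and (multiplicative) stretch $O(kn^{1/k}\cdot(k+n^{\epsilon/k}))$, whose query time is proportional to the length of the returned path.
   Context: $d_G$ is the shortest-path (hop) distance in $G$. A path-reporting distance oracle with stretch $\delta$ is a data structure that, given a query pair $u,v$, returns a $u$–$v$ path in $G$ of length at most $\delta\, d_G(u,v)$. Space is measured in words of $O(\log n)$ bits.
   Formalization: The space bound proved is O(max(kn/ε, n)), which equals O(kn/ε) when ε ≤ k; for ε much larger than k the bound O(kn/ε) is false, since an oracle for a tree determines the tree and so needs Ω(n) words. *)

theory Defs
  imports Complex_Main "HOL-Library.Extended_Real" "Graph_Theory.Graph_Theory"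
begin

text \<open>
  Queries are answered by a word RAM with \<open>w\<close>-bit words and unit-cost arithmetic. The data structure
  is a read-only array \<open>D\<close> of words, accessed by \<open>Data\<close>. Besides it, a query has registers and a
  random-access working memory, accessed by \<open>Mem\<close>. Every value computed is reduced modulo \<open>2 ^ w\<close>,
  so that words cannot carry more than \<open>w\<close> bits.
\<close>

datatype binop = Add | Sub | Mul | Div | Mod | Less | Equal

datatype expr =
    Const nat
  | Reg nat
  | Mem expr
  | Data expr
  | Bin binop expr expr

datatype com =
    Skip
  | Assign nat expr
  | Store expr expr
  | Seq com com
  | Cond expr com com
  | While expr com

type_synonym state = "(nat \<Rightarrow> nat) \<times> (nat \<Rightarrow> nat)" \<comment> \<open>registers, working memory\<close>

text \<open>\<open>Sub\<close> wraps around modulo \<open>2 ^ w\<close>; its second argument is always below \<open>2 ^ w\<close>.\<close>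

primrec binop_val :: "nat \<Rightarrow> binop \<Rightarrow> nat \<Rightarrow> nat \<Rightarrow> nat" where
  "binop_val w Add x y = (x + y) mod 2 ^ w"
| "binop_val w Sub x y = (x + 2 ^ w - y) mod 2 ^ w"
| "binop_val w Mul x y = (x * y) mod 2 ^ w"
| "binop_val w Div x y = (x div y) mod 2 ^ w"
| "binop_val w Mod x y = (x mod y) mod 2 ^ w"
| "binop_val w Less x y = of_bool (x < y) mod 2 ^ w"
| "binop_val w Equal x y = of_bool (x = y) mod 2 ^ w"

primrec expr_val :: "nat \<Rightarrow> nat list \<Rightarrow> state \<Rightarrow> expr \<Rightarrow> nat" where
  "expr_val w D s (Const c) = c mod 2 ^ w"
| "expr_val w D s (Reg r) = fst s r"
| "expr_val w D s (Mem e) = snd s (expr_val w D s e)"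
| "expr_val w D s (Data e) = (if expr_val w D s e < length D then D ! expr_val w D s e else 0)"
| "expr_val w D s (Bin f e1 e2) = binop_val w f (expr_val w D s e1) (expr_val w D s e2)"

primrec cost :: "expr \<Rightarrow> nat" where
  "cost (Const c) = 1"
| "cost (Reg r) = 1"
| "cost (Mem e) = 1 + cost e"
| "cost (Data e) = 1 + cost e"
| "cost (Bin f e1 e2) = 1 + cost e1 + cost e2"

text \<open>\<open>exec w D c s t s'\<close>: command \<open>c\<close>, started in \<open>s\<close>, halts in \<open>s'\<close> after \<open>t\<close> elementary steps.\<close>

inductive exec :: "nat \<Rightarrow> nat list \<Rightarrow> com \<Rightarrow> state \<Rightarrow> nat \<Rightarrow> state \<Rightarrow> bool"
  for w :: nat and D :: "nat list" where
  Skip: "exec w D Skip s 1 s"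
| Assign: "exec w D (Assign r e) s (1 + cost e) ((fst s)(r := expr_val w D s e), snd s)"
| Store: "exec w D (Store a e) s (1 + cost a + cost e)
            (fst s, (snd s)(expr_val w D s a := expr_val w D s e))"
| Seq: "exec w D c1 s t1 s' \<Longrightarrow> exec w D c2 s' t2 s'' \<Longrightarrow> exec w D (Seq c1 c2) s (t1 + t2) s''"
| CondTrue: "expr_val w D s e \<noteq> 0 \<Longrightarrow> exec w D c1 s t s' \<Longrightarrow>
            exec w D (Cond e c1 c2) s (1 + cost e + t) s'"
| CondFalse: "expr_val w D s e = 0 \<Longrightarrow> exec w D c2 s t s' \<Longrightarrow>
            exec w D (Cond e c1 c2) s (1 + cost e + t) s'"
| WhileFalse: "expr_val w D s e = 0 \<Longrightarrow> exec w D (While e c) s (1 + cost e) s"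
| WhileTrue: "expr_val w D s e \<noteq> 0 \<Longrightarrow> exec w D c s t1 s' \<Longrightarrow> exec w D (While e c) s' t2 s'' \<Longrightarrow>
            exec w D (While e c) s (1 + cost e + t1 + t2) s''"

inductive_cases exec_SkipE: "exec w D Skip s t s'"
inductive_cases exec_AssignE: "exec w D (Assign r e) s t s'"
inductive_cases exec_StoreE: "exec w D (Store a e) s t s'"
inductive_cases exec_SeqE: "exec w D (Seq c1 c2) s t s'"
inductive_cases exec_CondE: "exec w D (Cond e c1 c2) s t s'"
inductive_cases exec_WhileE: "exec w D (While e c) s t s'"

lemma exec_deterministic:
  "exec w D c s t s' \<Longrightarrow> exec w D c s t2 s2 \<Longrightarrow> t2 = t \<and> s2 = s'"
proof (induction arbitrary: t2 s2 rule: exec.induct)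
  case (Skip s)
  then show ?case by (rule exec_SkipE) simp
next
  case (Assign r e s)
  then show ?case by (rule exec_AssignE) simp
next
  case (Store a e s)
  then show ?case by (rule exec_StoreE) simp
next
  case (Seq c1 s t1 s' c2 t2' s'' u2 s2)
  obtain x1 m x2 where "exec w D c1 s x1 m" "exec w D c2 m x2 s2" "u2 = x1 + x2"
    by (rule exec_SeqE[OF Seq.prems])
  with Seq.IH show ?case by fastforce
next
  case (CondTrue s e c1 t s' c2)
  obtain x where "exec w D c1 s x s2" "t2 = 1 + cost e + x"
    by (rule exec_CondE[OF CondTrue.prems]) (use CondTrue.hyps in auto)
  with CondTrue.IH show ?case by fastforce
next
  case (CondFalse s e c2 t s' c1)
  obtain x where "exec w D c2 s x s2" "t2 = 1 + cost e + x"
    by (rule exec_CondE[OF CondFalse.prems]) (use CondFalse.hyps in auto)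
  with CondFalse.IH show ?case by fastforce
next
  case (WhileFalse s e c)
  show ?case
    by (rule exec_WhileE[OF WhileFalse.prems]) (use WhileFalse.hyps in auto)
next
  case (WhileTrue s e c t1 s' t2' s'' u2 s2)
  obtain x1 m x2 where "exec w D c s x1 m" "exec w D (While e c) m x2 s2"
      "u2 = 1 + cost e + x1 + x2"
    by (rule exec_WhileE[OF WhileTrue.prems]) (use WhileTrue.hyps in auto)
  with WhileTrue.IH show ?case by fastforce
qed

text \<open>
  The query pair is passed in registers 0 and 1; everything else starts at 0. On halting, register 0
  holds the start address and register 1 the number of entries of the answer in working memory.
\<close>

definition init_state :: "nat \<Rightarrow> nat \<Rightarrow> state" where
  "init_state u v = ((\<lambda>_. 0)(0 := u, 1 := v), \<lambda>_. 0)"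

definition reported_list :: "state \<Rightarrow> nat list" where
  "reported_list s = map (\<lambda>i. snd s (fst s 0 + i)) [0..<fst s 1]"

definition answers :: "nat \<Rightarrow> com \<Rightarrow> nat list \<Rightarrow> nat \<Rightarrow> nat \<Rightarrow> nat list \<Rightarrow> nat \<Rightarrow> bool" where
  "answers w query D u v p t \<longleftrightarrow> (\<exists>s. exec w D query (init_state u v) t s \<and> p = reported_list s)"

text \<open>Words of \<open>O(log n)\<close> bits; \<open>n + 1\<close> instead of \<open>n\<close> only matters for \<open>n = 1\<close>.\<close>

definition word_bits :: "nat \<Rightarrow> nat \<Rightarrow> nat" where
  "word_bits b n = b * nat \<lceil>log 2 (real n + 1)\<rceil>"

definition hop_dist :: "'a pair_pre_digraph \<Rightarrow> 'a \<Rightarrow> 'a \<Rightarrow> ereal" where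
  "hop_dist G u v = wf_digraph.\<mu> (with_proj G) (\<lambda>_. 1) u v"

text \<open>
  Vertices are natural numbers, so that they fit into words. Only pairs in a common component have a
  path to report.
\<close>

definition path_reporting_oracle ::
  "nat \<Rightarrow> com \<Rightarrow> nat list \<Rightarrow> nat pair_pre_digraph \<Rightarrow> real \<Rightarrow> bool" where
  "path_reporting_oracle w query D G \<delta> \<longleftrightarrow>
     (\<forall>x\<in>set D. x < 2 ^ w) \<and>
     (\<forall>u\<in>pverts G. \<forall>v\<in>pverts G. u \<rightarrow>\<^sup>*\<^bsub>with_proj G\<^esub> v \<longrightarrow>
        (\<exists>p t. answers w query D u v p t \<and>
           vpath p (with_proj G) \<and> hd p = u \<and> last p = v \<and>
           ereal (real (vwalk_length p)) \<le> ereal \<delta> * hop_dist G u v))"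

text \<open>The \<open>+ 1\<close> accounts for the queries with \<open>u = v\<close>, whose answer has length 0.\<close>

definition query_time_per_length ::
  "nat \<Rightarrow> com \<Rightarrow> nat list \<Rightarrow> nat pair_pre_digraph \<Rightarrow> real \<Rightarrow> bool" where
  "query_time_per_length w query D G \<tau> \<longleftrightarrow>
     (\<forall>u\<in>pverts G. \<forall>v\<in>pverts G. u \<rightarrow>\<^sup>*\<^bsub>with_proj G\<^esub> v \<longrightarrow>
        (\<forall>p t. answers w query D u v p t \<longrightarrow> real t \<le> \<tau> * (real (vwalk_length p) + 1)))"

end

theory Submission
  imports Defs
begin

text \<open>
  Put \<open>s = k / \<epsilon>\<close> and \<open>q = max 2 \<lceil>n powr (1 / s)\<rceil>\<close>. For each of the \<open>O(s + 1)\<close> scales \<open>r = q ^ i\<close> up to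
  the first with \<open>r \<ge> n\<close>, region growing yields clusters of total size \<open>2 n\<close> and depth \<open>O(r log n)\<close> such
  that every ball \<open>B(u, r)\<close> lies in one cluster, the home of \<open>u\<close> at that scale. A query looks for the first
  scale at which \<open>v\<close> belongs to the home of \<open>u\<close> and reports the tree path. Failure at the scale before
  means that the distance exceeds \<open>r / q\<close>, so the stretch is \<open>O(q log n)\<close>, and it also pays for the scan,
  since \<open>i \<le> q ^ i\<close>. The stated bound follows from \<open>1 + ln n \<le> k n powr (1 / k)\<close>.

  Membership is tested in constant time by a perfect hash function of linear size: the bucket of
  \<open>(c, v)\<close> is \<open>(c + T v) mod Q\<close> and its position is \<open>v\<close> plus the displacement of the bucket. Two keys of
  one bucket have different \<open>v\<close>, and no arithmetic hash family is needed because the tables \<open>T\<close> and \<open>d\<close>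
  may be chosen for the given set.
\<close>

section \<open>Sparse covers\<close>

text \<open>An arbitrary relation is allowed because region growing measures distances in the
  subgraph induced on the remaining vertices, \<open>Restr E H\<close>.\<close>

definition hop_ball :: "'a rel \<Rightarrow> nat \<Rightarrow> 'a \<Rightarrow> 'a set" where
  "hop_ball R m c = {y. \<exists>i\<le>m. (c, y) \<in> R ^^ i}"

lemma hop_ball_self: "c \<in> hop_ball R m c"
  unfolding hop_ball_def by (auto intro!: exI[of _ 0])

lemma hop_ball_trans:
  "y \<in> hop_ball R a x \<Longrightarrow> z \<in> hop_ball R b y \<Longrightarrow> z \<in> hop_ball R (a + b) x"
proof -
  assume "y \<in> hop_ball R a x" "z \<in> hop_ball R b y"
  then obtain i j where "i \<le> a" "(x, y) \<in> R ^^ i" "j \<le> b" "(y, z) \<in> R ^^ j"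
    unfolding hop_ball_def by blast
  then have "i + j \<le> a + b" "(x, z) \<in> R ^^ (i + j)" by (auto simp: relpow_add)
  then show ?thesis unfolding hop_ball_def by blast
qed

lemma relpow_sym: "sym R \<Longrightarrow> (x, y) \<in> R ^^ i \<Longrightarrow> (y, x) \<in> R ^^ i"
proof (induction i arbitrary: y)
  case (Suc i)
  then obtain z where "(x, z) \<in> R ^^ i" "(z, y) \<in> R" by auto
  with Suc have "(y, z) \<in> R" "(z, x) \<in> R ^^ i" by (auto dest: symD)
  then show ?case by (rule relpow_Suc_I2)
qed simp

lemma hop_ball_sym: "sym R \<Longrightarrow> y \<in> hop_ball R m x \<Longrightarrow> x \<in> hop_ball R m y"
  unfolding hop_ball_def by (auto dest: relpow_sym)

lemma hop_ball_subset: "c \<in> H \<Longrightarrow> hop_ball (Restr E H) m c \<subseteq> H"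
proof -
  assume "c \<in> H"
  have "y \<in> H" if "(c, y) \<in> (Restr E H) ^^ i" for y i
    using that \<open>c \<in> H\<close> by (cases i) auto
  then show ?thesis unfolding hop_ball_def by auto
qed

text \<open>A walk of length at most \<open>r\<close> from \<open>u\<close> stays inside the ball,
  so removing the disjoint set \<open>Y\<close> destroys none of its edges.\<close>

lemma hop_ball_avoid:
  assumes "hop_ball (Restr E H) r u \<inter> Y = {}"
  shows "hop_ball (Restr E H) r u \<subseteq> hop_ball (Restr E (H - Y)) r u"
proof -
  have "(u, y) \<in> (Restr E (H - Y)) ^^ i" if "i \<le> r" "(u, y) \<in> (Restr E H) ^^ i" for y i
    using that
  proof (induction i arbitrary: y)
    case (Suc i)
    then obtain z where z: "(u, z) \<in> (Restr E H) ^^ i" "(z, y) \<in> Restr E H" by auto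
    have "z \<in> hop_ball (Restr E H) r u" "y \<in> hop_ball (Restr E H) r u"
      using z(1) Suc.prems Suc_leD unfolding hop_ball_def by blast+
    with assms z Suc have "(u, z) \<in> (Restr E (H - Y)) ^^ i" "(z, y) \<in> Restr E (H - Y)" by auto
    then show ?case by (rule relpow_Suc_I)
  qed simp
  then show ?thesis unfolding hop_ball_def by blast
qed

definition rooted_tree :: "'a rel \<Rightarrow> 'a set \<Rightarrow> ('a \<Rightarrow> 'a) \<Rightarrow> ('a \<Rightarrow> nat) \<Rightarrow> bool" where
  "rooted_tree E S par dep \<longleftrightarrow>
     (\<forall>x\<in>S. dep x > 0 \<longrightarrow> par x \<in> S \<and> (x, par x) \<in> E \<and> dep x = Suc (dep (par x))) \<and>
     (\<forall>x\<in>S. \<forall>y\<in>S. dep x = 0 \<longrightarrow> dep y = 0 \<longrightarrow> x = y)"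

text \<open>The ascent from \<open>x\<close> passes through every depth from \<open>dep x\<close>
  down to 0.\<close>

lemma rooted_tree_depth_less_card:
  assumes "rooted_tree E S par dep" "finite S" "x \<in> S"
  shows "dep x < card S"
proof -
  have "x \<in> S \<Longrightarrow> {..dep x} \<subseteq> dep ` S" for x
  proof (induction "dep x" arbitrary: x)
    case 0
    then show ?case by force
  next
    case (Suc e)
    then have "par x \<in> S" "e = dep (par x)"
      using assms(1) unfolding rooted_tree_def by auto
    with Suc have "{..e} \<subseteq> dep ` S" by auto
    with Suc show ?case by (metis atMost_Suc insert_subset imageI)
  qed
  then have "card {..dep x} \<le> card S"
    using assms by (meson card_image_le card_mono finite_imageI le_trans)
  then show ?thesis by simp
qed

text \<open>Breadth-first search: the depth is the distance from \<open>c\<close>, and the parent is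
  a predecessor on a shortest walk.\<close>

lemma hop_ball_rooted_tree:
  fixes E :: "'a rel"
  assumes "sym R" "R \<subseteq> E"
  obtains par dep where "rooted_tree E (hop_ball R m c) par dep"
    "\<And>x. x \<in> hop_ball R m c \<Longrightarrow> dep x \<le> m"
proof -
  define dep where "dep x = (LEAST i. (c, x) \<in> R ^^ i)" for x
  have dep_le: "dep x \<le> i" if "(c, x) \<in> R ^^ i" for x i
    unfolding dep_def using that by (rule Least_le)
  have dep_pow: "(c, x) \<in> R ^^ dep x" if "x \<in> hop_ball R m c" for x
    using that unfolding dep_def hop_ball_def by (auto intro: LeastI)
  have dep_m: "dep x \<le> m" if "x \<in> hop_ball R m c" for x
    using that dep_le unfolding hop_ball_def by (auto intro: le_trans)
  define good where "good x y \<longleftrightarrow> y \<in> hop_ball R m c \<and> (x, y) \<in> E \<and> dep x = Suc (dep y)" for x y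
  have ex: "\<exists>y. good x y" if x: "x \<in> hop_ball R m c" "dep x > 0" for x
  proof -
    obtain j where j: "dep x = Suc j" using x by (cases "dep x") auto
    obtain y where y: "(c, y) \<in> R ^^ j" "(y, x) \<in> R" using dep_pow[OF x(1)] j by auto
    have yB: "y \<in> hop_ball R m c"
      using y(1) j dep_m[OF x(1)] unfolding hop_ball_def by (auto intro: exI[of _ j])
    have "(c, x) \<in> R ^^ Suc (dep y)" using dep_pow[OF yB] y(2) by auto
    then have "dep x \<le> Suc (dep y)" by (rule dep_le)
    with dep_le[OF y(1)] j have "dep y = j" by simp
    then show ?thesis unfolding good_def using yB y(2) j assms by (auto dest: symD)
  qed
  define par where "par x = (SOME y. good x y)" for x
  have par: "good x (par x)" if "x \<in> hop_ball R m c" "dep x > 0" for x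
    unfolding par_def using ex[OF that] by (rule someI_ex)
  have root: "x = c" if "x \<in> hop_ball R m c" "dep x = 0" for x
    using dep_pow[OF that(1)] that(2) by simp
  have "rooted_tree E (hop_ball R m c) par dep"
    unfolding rooted_tree_def using par root unfolding good_def by blast
  with dep_m show thesis using that by blast
qed

lemma exists_slow_growth:
  fixes f :: "nat \<Rightarrow> nat"
  assumes "f 0 \<ge> 1" "f L < 2 ^ L"
  shows "\<exists>j<L. f (Suc j) \<le> 2 * f j"
proof (rule ccontr)
  assume *: "\<not> ?thesis"
  have "j \<le> L \<Longrightarrow> f j \<ge> 2 ^ j" for j
  proof (induction j)
    case (Suc j)
    then have "f (Suc j) > 2 * f j" using * by (simp add: not_le)
    with Suc show ?case by simp
  qed (use assms in simp)
  with assms(2) show False by (simp add: leD)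
qed

text \<open>A cluster is given by its vertex set together with the parent and depth functions of a tree.\<close>

type_synonym 'a cluster = "'a set \<times> ('a \<Rightarrow> 'a) \<times> ('a \<Rightarrow> nat)"

definition good_cluster :: "'a rel \<Rightarrow> 'a set \<Rightarrow> nat \<Rightarrow> 'a cluster \<Rightarrow> bool" where
  "good_cluster E H m = (\<lambda>(S, par, dep). S \<subseteq> H \<and> rooted_tree E S par dep \<and> (\<forall>x\<in>S. dep x \<le> m))"

text \<open>
  Region growing in the graph induced on the vertices that are left: a ball of twice the size of its
  core is recorded as a cluster, but only the core is removed. The cores are therefore disjoint, and
  the first core that touches a ball \<open>B(u, r)\<close> belongs to a cluster that contains all of it.
\<close>

lemma sparse_cover:
  fixes E :: "'a rel"
  assumes "sym E" "finite H" "card H < 2 ^ L"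
  shows "\<exists>Cs. length Cs \<le> card H \<and> (\<Sum>C\<leftarrow>Cs. card (fst C)) \<le> 2 * card H \<and>
           (\<forall>C\<in>set Cs. good_cluster E H (2 * L * r) C) \<and>
           (\<forall>u\<in>H. \<exists>C\<in>set Cs. hop_ball (Restr E H) r u \<subseteq> fst C)"
  using assms(2,3)
proof (induction H rule: finite_psubset_induct)
  case (psubset H)
  show ?case
  proof (cases "H = {}")
    case True
    then show ?thesis by (auto intro!: exI[of _ "[]"])
  next
    case False
    then obtain c where c: "c \<in> H" by auto
    let ?R = "Restr E H"
    have symR: "sym ?R" using assms(1) by (auto simp: sym_def)
    have sub: "hop_ball ?R m c \<subseteq> H" for m using hop_ball_subset[OF c] .
    then have fin: "finite (hop_ball ?R m c)" for m using psubset.hyps by (meson finite_subset)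
    \<comment> \<open>Radii advance by \<open>2 * r\<close> so that a ball of radius
      \<open>r\<close> that meets the core fits into the next larger ball. Fewer than
      \<open>2 ^ L\<close> vertices leave no room for \<open>L\<close> doublings.\<close>
    have "\<exists>j<L. card (hop_ball ?R (2 * Suc j * r) c) \<le> 2 * card (hop_ball ?R (2 * j * r) c)"
    proof (rule exists_slow_growth)
      show "card (hop_ball ?R (2 * 0 * r) c) \<ge> 1"
        using fin hop_ball_self by (metis One_nat_def Suc_leI card_gt_0_iff empty_iff)
      show "card (hop_ball ?R (2 * L * r) c) < 2 ^ L"
        using psubset.prems card_mono[OF \<open>finite H\<close> sub] by (meson le_less_trans)
    qed
    then obtain j where j: "j < L"
      "card (hop_ball ?R (2 * Suc j * r) c) \<le> 2 * card (hop_ball ?R (2 * j * r) c)" by blast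
    define Y where "Y = hop_ball ?R (2 * j * r) c"
    define S where "S = hop_ball ?R (2 * Suc j * r) c"
    have Y: "Y \<subseteq> H" "finite Y" "c \<in> Y" unfolding Y_def using sub fin hop_ball_self by auto
    have cardH: "card H = card Y + card (H - Y)"
      using Y psubset.hyps by (simp add: card_Diff_subset card_mono)
    have cY: "card Y \<ge> 1" using Y by (metis One_nat_def Suc_leI card_gt_0_iff empty_iff)
    obtain par dep where tree: "rooted_tree E S par dep" "\<And>x. x \<in> S \<Longrightarrow> dep x \<le> 2 * Suc j * r"
      using hop_ball_rooted_tree[OF symR, of E "2 * Suc j * r" c] unfolding S_def by auto
    have "2 * Suc j * r \<le> 2 * L * r" using j(1) by (intro mult_right_mono) auto
    with tree sub have good: "good_cluster E H (2 * L * r) (S, par, dep)"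
      unfolding good_cluster_def S_def by (auto intro: le_trans)
    have "H - Y \<subset> H" using Y by auto
    moreover have "card (H - Y) < 2 ^ L" using psubset.prems cardH by simp
    ultimately obtain Cs where Cs: "length Cs \<le> card (H - Y)"
      "(\<Sum>C\<leftarrow>Cs. card (fst C)) \<le> 2 * card (H - Y)"
      "\<forall>C\<in>set Cs. good_cluster E (H - Y) (2 * L * r) C"
      "\<forall>u\<in>H - Y. \<exists>C\<in>set Cs. hop_ball (Restr E (H - Y)) r u \<subseteq> fst C"
      using psubset.IH[of "H - Y"] by blast
    have good_mono: "good_cluster E H m C" if "good_cluster E (H - Y) m C" for m C
      using that unfolding good_cluster_def by (auto split: prod.splits)
    show ?thesis
    proof (intro exI[of _ "(S, par, dep) # Cs"] conjI ballI)
      show "length ((S, par, dep) # Cs) \<le> card H" using Cs(1) cardH cY by simp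
      \<comment> \<open>The new cluster is charged to its core, which is removed for good.\<close>
      show "(\<Sum>C\<leftarrow>(S, par, dep) # Cs. card (fst C)) \<le> 2 * card H"
        using Cs(2) cardH j(2) unfolding Y_def S_def by simp
      show "good_cluster E H (2 * L * r) C" if "C \<in> set ((S, par, dep) # Cs)" for C
      proof (cases "C = (S, par, dep)")
        case False
        with that have "C \<in> set Cs" by simp
        with Cs(3) show ?thesis by (intro good_mono) blast
      next
        case True
        show ?thesis unfolding True by (rule good)
      qed
    next
      fix u assume u: "u \<in> H"
      show "\<exists>C\<in>set ((S, par, dep) # Cs). hop_ball ?R r u \<subseteq> fst C"
      proof (cases "hop_ball ?R r u \<inter> Y = {}")
        case True
        then have "u \<in> H - Y" using u hop_ball_self[of u ?R r] by blast
        then obtain C where "C \<in> set Cs" "hop_ball (Restr E (H - Y)) r u \<subseteq> fst C"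
          using Cs(4) by blast
        \<comment> \<open>A ball that misses the core is no smaller in the remaining graph, where
          the induction hypothesis covers it.\<close>
        with hop_ball_avoid[OF True] show ?thesis by (intro bexI[of _ C]) auto
      next
        case False
        then obtain y where y: "y \<in> hop_ball ?R r u" "y \<in> Y" by blast
        have "hop_ball ?R r u \<subseteq> S"
        proof
          fix z assume "z \<in> hop_ball ?R r u"
          \<comment> \<open>The walk goes from \<open>c\<close> to \<open>y\<close> in the core,
            then to \<open>u\<close>, then to \<open>z\<close>.\<close>
          with y have "z \<in> hop_ball ?R (2 * j * r + r + r) c"
            using hop_ball_sym[OF symR] hop_ball_trans unfolding Y_def by metis
          then show "z \<in> S" unfolding S_def by (simp add: algebra_simps)
        qed
        then show ?thesis by simp
      qed
    qed
  qed
qed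

section \<open>Perfect hashing\<close>

lemma add_mod_cancel_less:
  fixes a b t Q :: nat
  assumes "(a + t) mod Q = (b + t) mod Q" "a < Q" "b < Q"
  shows "a = b"
proof -
  have "a \<le> b" if "(a + t) mod Q = (b + t) mod Q" "a < Q" for a b
  proof (rule ccontr)
    assume "\<not> a \<le> b"
    then have "Q dvd (a + t) - (b + t)" using that(1) by (subst mod_eq_dvd_iff_nat[symmetric]) auto
    with \<open>\<not> a \<le> b\<close> that(2) show False by (auto dest: dvd_imp_le)
  qed
  with assms show ?thesis by (metis antisym)
qed

text \<open>One unit of shift moves the first term to the end, since
  \<open>(c + Q) mod Q = c mod Q\<close>.\<close>

lemma sum_shift_mod: "(\<Sum>t<Q. g ((c + t) mod Q)) = (\<Sum>t<Q. g t :: nat)" for Q c :: nat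
proof (induction c)
  case (Suc c)
  have "(\<Sum>t<Q. g ((Suc c + t) mod Q)) + g (c mod Q) = (\<Sum>t<Suc Q. g ((c + t) mod Q))"
    by (subst sum.lessThan_Suc_shift) simp
  then show ?case using Suc by simp
qed simp

text \<open>A key is a pair of a cluster index and a vertex. For indices below \<open>Q\<close>, a
  bucket holds at most one key per vertex.\<close>

definition bucket :: "nat \<Rightarrow> (nat \<Rightarrow> nat) \<Rightarrow> (nat \<times> nat) set \<Rightarrow> nat \<Rightarrow> (nat \<times> nat) set" where
  "bucket Q T P j = {p \<in> P. (fst p + T (snd p)) mod Q = j}"

text \<open>
  The shifts \<open>T v\<close> are chosen one column after the other. Averaging over all \<open>Q\<close> shifts, the entries
  of a new column meet at most as many of the old entries as if these were spread evenly.
\<close>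

lemma exists_balanced_shifts:
  assumes "P \<subseteq> {..<Q} \<times> {..<n}" "Q > 0"
  shows "\<exists>T. (\<forall>v. T v < Q) \<and>
    Q * (\<Sum>j<Q. (card (bucket Q T P j))\<^sup>2) \<le> Q * card P + (card P)\<^sup>2"
  using assms(1)
proof (induction n arbitrary: P)
  case 0
  then have "P = {}" by auto
  with assms(2) show ?case by (auto simp: bucket_def intro!: exI[of _ "\<lambda>_. 0"])
next
  case (Suc n)
  define P' where "P' = {p \<in> P. snd p < n}"
  define S where "S = {c. (c, n) \<in> P}"
  have P: "P = P' \<union> (\<lambda>c. (c, n)) ` S" "P' \<inter> (\<lambda>c. (c, n)) ` S = {}"
    using Suc.prems unfolding P'_def S_def by (fastforce simp: less_Suc_eq)+
  have sub: "P' \<subseteq> {..<Q} \<times> {..<n}" "S \<subseteq> {..<Q}" using Suc.prems unfolding P'_def S_def by auto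
  then have fin: "finite P'" "finite S" by (auto intro: finite_subset)
  have cardP: "card P = card P' + card S"
    using P fin by (simp add: card_Un_disjoint card_image inj_on_def)
  obtain T where T: "\<forall>v. T v < Q"
    "Q * (\<Sum>j<Q. (card (bucket Q T P' j))\<^sup>2) \<le> Q * card P' + (card P')\<^sup>2"
    using Suc.IH[OF sub(1)] by blast
  define b where "b j = card (bucket Q T P' j)" for j
  define e where "e t j = card {c \<in> S. (c + t) mod Q = j}" for t j
  have b_sum: "(\<Sum>j<Q. b j) = card P'"
  proof -
    have "card P' = card (\<Union>j<Q. bucket Q T P' j)"
      using assms(2) by (intro arg_cong[of _ _ card]) (auto simp: bucket_def)
    also have "\<dots> = (\<Sum>j<Q. b j)" unfolding b_def
      by (rule card_UN_disjoint) (use fin in \<open>auto simp: bucket_def\<close>)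
    finally show ?thesis by simp
  qed
  \<comment> \<open>Distinct indices below \<open>Q\<close> stay distinct modulo \<open>Q\<close>
    after a common shift.\<close>
  have e_le: "e t j \<le> 1" for t j
  proof -
    have "x = y" if "x \<in> {c \<in> S. (c + t) mod Q = j}" "y \<in> {c \<in> S. (c + t) mod Q = j}" for x y
    proof (rule add_mod_cancel_less)
      show "(x + t) mod Q = (y + t) mod Q" using that by simp
      show "x < Q" "y < Q" using that sub(2) by auto
    qed
    moreover have "finite {c \<in> S. (c + t) mod Q = j}" using fin by simp
    ultimately show ?thesis
      unfolding e_def One_nat_def by (subst card_le_Suc0_iff_eq) blast+
  qed
  have e_sum: "(\<Sum>j<Q. g j * e t j) = (\<Sum>c\<in>S. g ((c + t) mod Q))" for g :: "nat \<Rightarrow> nat" and t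
  proof -
    have "g j * e t j = (\<Sum>c\<in>S. if j = (c + t) mod Q then g j else 0)" for j
    proof -
      have "(\<Sum>c\<in>S. if j = (c + t) mod Q then g j else 0) = (\<Sum>c\<in>{c \<in> S. j = (c + t) mod Q}. g j)"
        using fin(2) by (rule sum.inter_filter[symmetric])
      also have "{c \<in> S. j = (c + t) mod Q} = {c \<in> S. (c + t) mod Q = j}" by blast
      finally show ?thesis unfolding e_def by simp
    qed
    then have "(\<Sum>j<Q. g j * e t j) = (\<Sum>j<Q. \<Sum>c\<in>S. if j = (c + t) mod Q then g j else 0)"
      by (rule sum.cong[OF refl])
    also have "\<dots> = (\<Sum>c\<in>S. \<Sum>j<Q. if j = (c + t) mod Q then g j else 0)" by (rule sum.swap)
    also have "\<dots> = (\<Sum>c\<in>S. g ((c + t) mod Q))" using assms(2) by (simp add: sum.delta')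
    finally show ?thesis .
  qed
  \<comment> \<open>Over all shifts \<open>t\<close> each entry of the new column visits every
    bucket once, so the overlaps add up to \<open>card P' * card S\<close>, and some shift is no
    worse than the average.\<close>
  have "\<exists>t<Q. Q * (\<Sum>j<Q. b j * e t j) \<le> card P' * card S"
  proof (rule ccontr)
    assume "\<not> ?thesis"
    then have "(\<Sum>t<Q. Q * (\<Sum>j<Q. b j * e t j)) > (\<Sum>t<Q. card P' * card S)"
      using assms(2) by (intro sum_strict_mono) (auto simp: not_le)
    moreover have "(\<Sum>t<Q. \<Sum>j<Q. b j * e t j) = card P' * card S"
      unfolding e_sum by (subst sum.swap) (simp add: sum_shift_mod b_sum)
    ultimately show False by (simp flip: sum_distrib_left)
  qed
  then obtain t where t: "t < Q" "Q * (\<Sum>j<Q. b j * e t j) \<le> card P' * card S" by blast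
  have new: "card (bucket Q (T(n := t)) P j) = b j + e t j" for j
  proof -
    have "bucket Q (T(n := t)) P j = bucket Q T P' j \<union> (\<lambda>c. (c, n)) ` {c \<in> S. (c + t) mod Q = j}"
      using sub unfolding bucket_def by (subst P(1)) auto
    moreover have "bucket Q T P' j \<inter> (\<lambda>c. (c, n)) ` {c \<in> S. (c + t) mod Q = j} = {}"
      using sub unfolding bucket_def by auto
    moreover have "finite (bucket Q T P' j)" using fin unfolding bucket_def by auto
    ultimately show ?thesis
      unfolding b_def e_def using fin by (simp add: card_Un_disjoint card_image inj_on_def)
  qed
  \<comment> \<open>Since \<open>e t j\<close> is 0 or 1, it equals its own square, so the new
    column adds only a linear term and the cross term.\<close>
  have sq: "(b j + e t j)\<^sup>2 = (b j)\<^sup>2 + 2 * (b j * e t j) + 1 * e t j" for j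
    using e_le[of t j] by (cases "e t j") (auto simp: power2_eq_square algebra_simps)
  have "(\<Sum>j<Q. 1 * e t j) = card S" by (subst e_sum) simp
  then have "(\<Sum>j<Q. (b j + e t j)\<^sup>2) = (\<Sum>j<Q. (b j)\<^sup>2) + 2 * (\<Sum>j<Q. b j * e t j) + card S"
    unfolding sq by (simp add: sum.distrib sum_distrib_left)
  then have "Q * (\<Sum>j<Q. (b j + e t j)\<^sup>2) =
      Q * (\<Sum>j<Q. (b j)\<^sup>2) + 2 * (Q * (\<Sum>j<Q. b j * e t j)) + Q * card S"
    by (simp add: algebra_simps)
  also have "\<dots> \<le> Q * card P' + (card P')\<^sup>2 + 2 * (card P' * card S) + Q * card S"
    using T(2) t(2) unfolding b_def by (intro add_mono mult_left_mono) auto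
  also have "\<dots> \<le> Q * card P + (card P)\<^sup>2"
    unfolding cardP by (simp add: power2_eq_square algebra_simps)
  finally have "Q * (\<Sum>j<Q. (card (bucket Q (T(n := t)) P j))\<^sup>2) \<le> Q * card P + (card P)\<^sup>2"
    unfolding new[symmetric] .
  moreover have "\<forall>v. (T(n := t)) v < Q" using T(1) t(1) by simp
  ultimately show ?case by blast
qed

text \<open>
  Buckets are placed by decreasing size, so that all buckets in place when \<open>X j\<close> comes are at least as
  large as \<open>X j\<close>, and the sum of squares bounds the number of offsets that lead to a conflict.
\<close>

lemma exists_displacements:
  fixes X :: "'a \<Rightarrow> nat set"
  assumes "finite J" "\<And>j. j \<in> J \<Longrightarrow> finite (X j)" "(\<Sum>j\<in>J. (card (X j))\<^sup>2) < M"
  shows "\<exists>d. (\<forall>j. d j < M) \<and> inj_on (\<lambda>(j, v). v + d j) (Sigma J X)"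
  using assms
proof (induction "card J" arbitrary: J)
  case 0
  then show ?case by (auto intro!: exI[of _ "\<lambda>_. 0"])
next
  case (Suc k)
  then have "J \<noteq> {}" by auto
  then obtain j where j: "j \<in> J" "\<And>i. i \<in> J \<Longrightarrow> card (X j) \<le> card (X i)"
    using ex_has_least_nat[of "\<lambda>i. i \<in> J" _ "\<lambda>i. card (X i)"] by blast
  define J' where "J' = J - {j}"
  have le: "(\<Sum>i\<in>J'. (card (X i))\<^sup>2) \<le> (\<Sum>i\<in>J. (card (X i))\<^sup>2)"
    unfolding J'_def using Suc.prems(1) by (intro sum_mono2) auto
  obtain d where d: "\<forall>i. d i < M" "inj_on (\<lambda>(i, v). v + d i) (Sigma J' X)"
  proof -
    have "k = card J'" using Suc.hyps(2) j(1) unfolding J'_def by simp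
    moreover have "finite J'" "\<And>i. i \<in> J' \<Longrightarrow> finite (X i)" "(\<Sum>i\<in>J'. (card (X i))\<^sup>2) < M"
      using Suc.prems le unfolding J'_def by auto
    ultimately show thesis using Suc.hyps(1) that by blast
  qed
  define U where "U = (\<lambda>(i, v). v + d i) ` Sigma J' X"
  define F where "F = (\<lambda>(a, v). a - v) ` (U \<times> X j)"
  have finU: "finite U" unfolding U_def J'_def using Suc.prems by auto
  have "card F \<le> card U * card (X j)" unfolding F_def
    using finU Suc.prems(2)[OF j(1)] by (metis card_cartesian_product card_image_le finite_cartesian_product)
  also have "card U \<le> card (Sigma J' X)" unfolding U_def
    using Suc.prems by (intro card_image_le) (auto simp: J'_def)
  also have "card (Sigma J' X) = (\<Sum>i\<in>J'. card (X i))"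
    using Suc.prems by (intro card_SigmaI) (auto simp: J'_def)
  \<comment> \<open>\<open>X j\<close> is a smallest bucket, so each product is at most a
    square.\<close>
  also have "\<dots> * card (X j) \<le> (\<Sum>i\<in>J'. (card (X i))\<^sup>2)"
    unfolding sum_distrib_right power2_eq_square using j(2)
    by (intro sum_mono mult_left_mono) (auto simp: J'_def)
  also have "\<dots> < M" using le Suc.prems(3) by simp
  finally have "card F < card {..<M}" by simp
  moreover have "finite F" unfolding F_def using finU Suc.prems(2)[OF j(1)] by auto
  ultimately obtain t where t: "t < M" "t \<notin> F"
    by (metis card_mono lessThan_iff linorder_not_less subsetI)
  have tU: "v + t \<notin> U" if "v \<in> X j" for v
    using that t(2) unfolding F_def by force
  have "inj_on (\<lambda>(i, v). v + (d(j := t)) i) (Sigma J X)"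
  proof (rule inj_onI)
    fix p p'
    assume p: "p \<in> Sigma J X" "p' \<in> Sigma J X"
      "(\<lambda>(i, v). v + (d(j := t)) i) p = (\<lambda>(i, v). v + (d(j := t)) i) p'"
    obtain i v i' v' where eqs: "p = (i, v)" "p' = (i', v')" by (cases p, cases p')
    have *: "i \<in> J" "v \<in> X i" "i' \<in> J" "v' \<in> X i'"
        "v + (if i = j then t else d i) = v' + (if i' = j then t else d i')"
      using p unfolding eqs by auto
    have U: "v + d i \<in> U" if "i \<noteq> j" "i \<in> J" "v \<in> X i" for v i
      using that unfolding U_def J'_def by force
    show "p = p'"
    proof (cases "i = j"; cases "i' = j")
      assume "i \<noteq> j" "i' \<noteq> j"
      then show ?thesis
        using * inj_onD[OF d(2), of "(i, v)" "(i', v')"] unfolding eqs by (auto simp: J'_def)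
    next
      assume "i = j" "i' \<noteq> j"
      then show ?thesis using * tU[of v] U[of i' v'] by simp
    next
      assume "i \<noteq> j" "i' = j"
      then show ?thesis using * tU[of v'] U[of i v] by simp
    qed (use * eqs in simp)
  qed
  with d(1) t(1) show ?case by (intro exI[of _ "d(j := t)"]) auto
qed

text \<open>With at most \<open>Q\<close> keys the sum of squares is at most \<open>2 * Q\<close>,
  so \<open>2 * Q + 1\<close> offsets suffice. The position determines bucket and vertex, and these
  determine the cluster index.\<close>

lemma exists_perfect_hash:
  assumes "P \<subseteq> {..<Q} \<times> {..<n}" "Q > 0" "card P \<le> Q"
  obtains T d where "\<And>v. T v < Q" "\<And>j. d j < 2 * Q + 1"
    "inj_on (\<lambda>(c, v). v + d ((c + T v) mod Q)) P"
proof -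
  obtain T where T: "\<forall>v. T v < Q"
    "Q * (\<Sum>j<Q. (card (bucket Q T P j))\<^sup>2) \<le> Q * card P + (card P)\<^sup>2"
    using exists_balanced_shifts[OF assms(1,2)] by blast
  have finP: "finite P" using assms(1) by (rule finite_subset) auto
  then have finb: "finite (bucket Q T P j)" for j unfolding bucket_def by auto
  have "Q * (\<Sum>j<Q. (card (bucket Q T P j))\<^sup>2) \<le> Q * card P + card P * card P"
    using T(2) by (simp add: power2_eq_square)
  also have "\<dots> \<le> Q * Q + Q * Q" using assms(3) by (intro add_mono mult_mono) auto
  also have "\<dots> = Q * (2 * Q)" by simp
  finally have "Q * (\<Sum>j<Q. (card (bucket Q T P j))\<^sup>2) \<le> Q * (2 * Q)" .
  then have sq: "(\<Sum>j<Q. (card (bucket Q T P j))\<^sup>2) \<le> 2 * Q"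
    using assms(2) by (metis mult_le_cancel1)
  define X where "X j = snd ` bucket Q T P j" for j
  have "(\<Sum>j<Q. (card (X j))\<^sup>2) \<le> (\<Sum>j<Q. (card (bucket Q T P j))\<^sup>2)"
    unfolding X_def using finb by (intro sum_mono power_mono card_image_le) auto
  with sq have "(\<Sum>j<Q. (card (X j))\<^sup>2) < 2 * Q + 1" by simp
  with finb obtain d where d: "\<forall>j. d j < 2 * Q + 1" "inj_on (\<lambda>(j, v). v + d j) (Sigma {..<Q} X)"
    using exists_displacements[of "{..<Q}" X "2 * Q + 1"] unfolding X_def by blast
  have "inj_on (\<lambda>(c, v). v + d ((c + T v) mod Q)) P"
  proof (rule inj_onI, clarsimp)
    fix c v c' v'
    assume *: "(c, v) \<in> P" "(c', v') \<in> P" "v + d ((c + T v) mod Q) = v' + d ((c' + T v') mod Q)"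
    have X: "((c + T v) mod Q, v) \<in> Sigma {..<Q} X" if "(c, v) \<in> P" for c v
      using that assms(2) unfolding X_def bucket_def by force
    have "((c + T v) mod Q, v) = ((c' + T v') mod Q, v')"
      by (rule inj_onD[OF d(2) _ X[OF *(1)] X[OF *(2)]]) (simp add: *(3))
    with * assms(1) show "c = c' \<and> v = v'" using add_mod_cancel_less by blast
  qed
  with T(1) d(1) show thesis using that by blast
qed

section \<open>Tree paths\<close>

text \<open>The two-pointer climb of the query: the deeper end, on ties the left one, moves to its
  parent. \<open>xs\<close> and \<open>ys\<close> list the vertices left behind on either side in
  climbing order, and \<open>z\<close> is the meeting vertex.\<close>

inductive tree_path :: "('a \<Rightarrow> 'a) \<Rightarrow> ('a \<Rightarrow> nat) \<Rightarrow> 'a \<Rightarrow> 'a \<Rightarrow> 'a list \<Rightarrow> 'a \<Rightarrow> 'a list \<Rightarrow> bool"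
  for par dep where
  meet: "tree_path par dep a a [] a []"
| left: "a \<noteq> b \<Longrightarrow> dep b \<le> dep a \<Longrightarrow> tree_path par dep (par a) b xs z ys \<Longrightarrow>
    tree_path par dep a b (a # xs) z ys"
| right: "a \<noteq> b \<Longrightarrow> dep a < dep b \<Longrightarrow> tree_path par dep a (par b) xs z ys \<Longrightarrow>
    tree_path par dep a b xs z (b # ys)"

lemma rooted_tree_parent:
  assumes "rooted_tree E S par dep" "x \<in> S" "dep x > 0"
  shows "par x \<in> S" "(x, par x) \<in> E" "dep x = Suc (dep (par x))"
  using assms unfolding rooted_tree_def by auto

lemma rooted_tree_deeper:
  assumes "rooted_tree E S par dep" "a \<in> S" "b \<in> S" "a \<noteq> b" "dep b \<le> dep a"
  shows "dep a > 0"
  using assms unfolding rooted_tree_def by (metis le_zero_eq not_gr_zero)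

lemma tree_path_exists:
  assumes "rooted_tree E S par dep" "a \<in> S" "b \<in> S"
  shows "\<exists>xs z ys. tree_path par dep a b xs z ys"
  using assms(2,3)
proof (induction "dep a + dep b" arbitrary: a b rule: less_induct)
  case less
  consider "a = b" | "a \<noteq> b" "dep b \<le> dep a" | "a \<noteq> b" "dep a < dep b" by linarith
  then show ?case
  proof cases
    case 1
    then show ?thesis by (auto intro: tree_path.meet)
  next
    case 2
    then have "dep a > 0" using rooted_tree_deeper[OF assms(1)] less.prems by blast
    from rooted_tree_parent[OF assms(1) less.prems(1) this] show ?thesis
      using less.hyps[of "par a" b] less.prems tree_path.left[of a b dep par] 2 by fastforce
  next
    case 3
    then have "dep b > 0" by simp
    from rooted_tree_parent[OF assms(1) less.prems(2) this] show ?thesis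
      using less.hyps[of a "par b"] less.prems tree_path.right[of a b dep par] 3 by fastforce
  qed
qed

text \<open>The depth condition makes the induction for distinctness go through.\<close>

definition tree_vpath :: "'a rel \<Rightarrow> 'a set \<Rightarrow> ('a \<Rightarrow> nat) \<Rightarrow> 'a \<Rightarrow> 'a \<Rightarrow> 'a list \<Rightarrow> bool" where
  "tree_vpath E S dep a b p \<longleftrightarrow> p \<noteq> [] \<and> hd p = a \<and> last p = b \<and> distinct p \<and> set p \<subseteq> S \<and>
     set (vwalk_arcs p) \<subseteq> E \<and> (\<forall>x\<in>set p. dep x < max (dep a) (dep b) \<or> x = a \<or> x = b)"

text \<open>The vertex \<open>a\<close> is deeper than \<open>c\<close> and, being different from
  \<open>b\<close>, at least as deep as \<open>b\<close>; the depth condition therefore keeps it off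
  \<open>p\<close>.\<close>

lemma tree_vpath_Cons:
  assumes "tree_vpath E S dep c b p" "a \<in> S" "(a, c) \<in> E" "dep a = Suc (dep c)"
    "a \<noteq> b" "dep b \<le> dep a"
  shows "tree_vpath E S dep a b (a # p)"
proof -
  have p: "p \<noteq> []" "hd p = c" "\<And>x. x \<in> set p \<Longrightarrow> dep x < max (dep c) (dep b) \<or> x = c \<or> x = b"
    using assms(1) unfolding tree_vpath_def by auto
  have "a \<notin> set p" using p(3)[of a] assms(4-6) by auto
  moreover have "dep x < max (dep a) (dep b) \<or> x = a \<or> x = b" if "x \<in> set p" for x
    using p(3)[OF that] assms(4) by auto
  ultimately show ?thesis using assms(1-3) p(1,2) unfolding tree_vpath_def by auto
qed

lemma tree_vpath_snoc:
  assumes "tree_vpath E S dep a c p" "b \<in> S" "(c, b) \<in> E" "dep b = Suc (dep c)"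
    "a \<noteq> b" "dep a < dep b"
  shows "tree_vpath E S dep a b (p @ [b])"
proof -
  have p: "p \<noteq> []" "last p = c" "\<And>x. x \<in> set p \<Longrightarrow> dep x < max (dep a) (dep c) \<or> x = a \<or> x = c"
    using assms(1) unfolding tree_vpath_def by auto
  have "b \<notin> set p" using p(3)[of b] assms(4-6) by auto
  moreover have "dep x < max (dep a) (dep b) \<or> x = a \<or> x = b" if "x \<in> set p" for x
    using p(3)[OF that] assms(4) by auto
  moreover have "vwalk_arcs (p @ [b]) = vwalk_arcs p @ [(c, b)]"
    using p(1,2) by (simp add: vwalk_arcs_append)
  ultimately show ?thesis using assms(1-3) p(1,2) unfolding tree_vpath_def by auto
qed

text \<open>Each recorded vertex uses up one unit of depth on its side. The climb from
  \<open>b\<close> is reversed so that it leads down to \<open>b\<close>.\<close>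

lemma tree_path_vpath:
  assumes "tree_path par dep a b xs z ys" "rooted_tree E S par dep" "sym E" "a \<in> S" "b \<in> S"
  shows "length xs + length ys \<le> dep a + dep b \<and> tree_vpath E S dep a b (xs @ z # rev ys)"
  using assms(1,4,5)
proof induction
  case (meet a)
  then show ?case by (simp add: tree_vpath_def)
next
  case (left a b xs z ys)
  note d = rooted_tree_deeper[OF assms(2) left.prems left.hyps(1,2)]
  note par = rooted_tree_parent[OF assms(2) left.prems(1) d]
  note IH = left.IH[OF par(1) left.prems(2)]
  have "tree_vpath E S dep a b (a # (xs @ z # rev ys))"
    using IH left.prems left.hyps par by (intro tree_vpath_Cons[of _ _ _ "par a"]) auto
  with IH par(3) show ?case by simp
next
  case (right a b xs z ys)
  have d: "dep b > 0" using right.hyps by simp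
  note par = rooted_tree_parent[OF assms(2) right.prems(2) d]
  note IH = right.IH[OF right.prems(1) par(1)]
  have "tree_vpath E S dep a b ((xs @ z # rev ys) @ [b])"
    using IH right.prems right.hyps par assms(3)
    by (intro tree_vpath_snoc[of _ _ _ _ "par b"]) (auto dest: symD)
  with IH par(3) show ?case by simp
qed

text \<open>The ascent from \<open>b\<close> without reference to the other side, which is what the
  second pass of the query replays.\<close>

fun climb :: "('a \<Rightarrow> 'a) \<Rightarrow> 'a \<Rightarrow> 'a list \<Rightarrow> bool" where
  "climb par b [] = True"
| "climb par b (y # ys) = (y = b \<and> climb par (par b) ys)"

lemma tree_path_climb:
  "tree_path par dep a b xs z ys \<Longrightarrow> climb par b ys \<and> (\<forall>y\<in>set ys. dep y > 0)"
  by (induction rule: tree_path.induct) (simp_all add: gr_zeroI)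

section \<open>Execution of loop-free commands\<close>

text \<open>The functions \<open>run\<close> and \<open>com_cost\<close> have junk values on loops.\<close>

primrec loop_free :: "com \<Rightarrow> bool" where
  "loop_free Skip = True"
| "loop_free (Assign r e) = True"
| "loop_free (Store a e) = True"
| "loop_free (Seq c1 c2) = (loop_free c1 \<and> loop_free c2)"
| "loop_free (Cond e c1 c2) = (loop_free c1 \<and> loop_free c2)"
| "loop_free (While e c) = False"

primrec run :: "nat \<Rightarrow> nat list \<Rightarrow> com \<Rightarrow> state \<Rightarrow> state" where
  "run w D Skip s = s"
| "run w D (Assign r e) s = ((fst s)(r := expr_val w D s e), snd s)"
| "run w D (Store a e) s = (fst s, (snd s)(expr_val w D s a := expr_val w D s e))"
| "run w D (Seq c1 c2) s = run w D c2 (run w D c1 s)"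
| "run w D (Cond e c1 c2) s = (if expr_val w D s e \<noteq> 0 then run w D c1 s else run w D c2 s)"
| "run w D (While e c) s = s"

primrec com_cost :: "com \<Rightarrow> nat" where
  "com_cost Skip = 1"
| "com_cost (Assign r e) = 1 + cost e"
| "com_cost (Store a e) = 1 + cost a + cost e"
| "com_cost (Seq c1 c2) = com_cost c1 + com_cost c2"
| "com_cost (Cond e c1 c2) = 1 + cost e + com_cost c1 + com_cost c2"
| "com_cost (While e c) = 0"

text \<open>\<open>com_cost\<close> charges both branches of a conditional, so it bounds the time
  independently of the state.\<close>

lemma exec_run: "loop_free c \<Longrightarrow> \<exists>t\<le>com_cost c. exec w D c s t (run w D c s)"
proof (induction c arbitrary: s)
  case (Seq c1 c2)
  obtain t1 where "t1 \<le> com_cost c1" "exec w D c1 s t1 (run w D c1 s)" using Seq by fastforce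
  moreover obtain t2 where "t2 \<le> com_cost c2"
    "exec w D c2 (run w D c1 s) t2 (run w D c2 (run w D c1 s))" using Seq by fastforce
  ultimately show ?case using exec.Seq by (intro exI[of _ "t1 + t2"]) auto
next
  case (Cond e c1 c2)
  obtain t1 where t1: "t1 \<le> com_cost c1" "exec w D c1 s t1 (run w D c1 s)" using Cond by fastforce
  obtain t2 where t2: "t2 \<le> com_cost c2" "exec w D c2 s t2 (run w D c2 s)" using Cond by fastforce
  show ?case
  proof (cases "expr_val w D s e = 0")
    case True
    from exec.CondFalse[OF True t2(2)] True t2(1) show ?thesis
      by (intro exI[of _ "1 + cost e + t2"]) auto
  next
    case False
    from exec.CondTrue[OF False t1(2)] False t1(1) show ?thesis
      by (intro exI[of _ "1 + cost e + t1"]) auto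
  qed
next
  case Skip
  show ?case using exec.Skip[of w D s] by auto
next
  case (Assign r e)
  show ?case by (auto intro!: exI[of _ "1 + cost e"] exec.Assign[simplified])
next
  case (Store a e)
  show ?case by (auto intro!: exI[of _ "1 + cost a + cost e"] exec.Store[simplified])
qed simp

section \<open>The query program\<close>

text \<open>
  The data structure is an array of records of eight words. Field 0 holds the shift of a vertex, field 1
  the displacement of a bucket, field 2 the home cluster of vertex \<open>u\<close> at scale \<open>i\<close> (record
  \<open>i * n + u\<close>), and field 7 the number of vertices (record 0) and of buckets (record 1). The tree node
  for vertex \<open>v\<close> of cluster \<open>c\<close> is stored at its hash position: fields 3 to 6 are \<open>c + 1\<close>, \<open>v\<close>,
  the depth, and the position of the parent.
\<close>

definition field :: "nat \<Rightarrow> expr \<Rightarrow> expr" where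
  "field f e = Data (Bin Add (Bin Mul (Const 8) e) (Const f))"

definition hash_expr :: "expr \<Rightarrow> expr \<Rightarrow> expr" where
  "hash_expr c v = Bin Add v (field 1 (Bin Mod (Bin Add c (field 0 v)) (Data (Const 15))))"

text \<open>Conjunction by arithmetic: the two tests add up to 2 exactly if the record belongs to
  the wanted key. Cluster indices are stored plus one so that an empty record, which holds 0, never
  matches.\<close>

definition missing_expr :: expr where
  "missing_expr = Bin Less (Bin Add (Bin Equal (field 3 (Reg 4)) (Bin Add (Reg 3) (Const 1)))
     (Bin Equal (field 4 (Reg 4)) (Reg 1))) (Const 2)"

text \<open>Register 2 is the record of the current scale, 3 the home cluster, 4 the position of
  \<open>v\<close>. Registers 5 and 6 are the climbing ends, 7 the length of the left part, 8 that
  of the right part.\<close>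

definition lookup_com :: com where
  "lookup_com = Seq (Assign 3 (field 2 (Reg 2))) (Assign 4 (hash_expr (Reg 3) (Reg 1)))"

definition next_com :: com where
  "next_com = Seq (Assign 2 (Bin Add (Reg 2) (Data (Const 7)))) lookup_com"

text \<open>Registers 5 and 6 hold hash positions instead of vertices, so a step to the parent is
  one table access without rehashing.\<close>

definition climb_com :: com where
  "climb_com = Cond (Bin Less (field 5 (Reg 5)) (field 5 (Reg 6)))
     (Seq (Assign 6 (field 6 (Reg 6))) (Assign 8 (Bin Add (Reg 8) (Const 1))))
     (Seq (Store (Reg 7) (field 4 (Reg 5)))
       (Seq (Assign 5 (field 6 (Reg 5))) (Assign 7 (Bin Add (Reg 7) (Const 1)))))"

definition write_com :: com where
  "write_com = Seq (Store (Reg 8) (field 4 (Reg 4)))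
     (Seq (Assign 4 (field 6 (Reg 4))) (Assign 8 (Bin Sub (Reg 8) (Const 1))))"

text \<open>
  The number of vertices on the side of \<open>v\<close> is only known once the two sides have met, so these
  are written in a second climb, backwards from the end of the answer.
\<close>

definition query_com :: com where
  "query_com =
     Seq (Seq (Assign 2 (Reg 0)) lookup_com)
    (Seq (While missing_expr next_com)
    (Seq (Seq (Assign 5 (hash_expr (Reg 3) (Reg 0))) (Assign 6 (Reg 4)))
    (Seq (While (Bin Equal (Bin Equal (Reg 5) (Reg 6)) (Const 0)) climb_com)
    (Seq (Seq (Store (Reg 7) (field 4 (Reg 5)))
         (Seq (Assign 8 (Bin Add (Reg 7) (Reg 8)))
         (Seq (Assign 1 (Bin Add (Reg 8) (Const 1))) (Assign 0 (Const 0)))))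
    (While (Bin Less (Reg 7) (Reg 8)) write_com)))))"

text \<open>One summand per stage: the cost of a straight-line block, or of one loop iteration with
  its test.\<close>

definition query_cost :: nat where
  "query_cost =
     com_cost (Seq (Assign 2 (Reg 0)) lookup_com)
   + (1 + cost missing_expr + com_cost next_com
   + (com_cost (Seq (Assign 5 (hash_expr (Reg 3) (Reg 0))) (Assign 6 (Reg 4)))
   + (1 + cost (Bin Equal (Bin Equal (Reg 5) (Reg 6)) (Const 0)) + com_cost climb_com
   + (com_cost (Seq (Store (Reg 7) (field 4 (Reg 5)))
         (Seq (Assign 8 (Bin Add (Reg 7) (Reg 8)))
         (Seq (Assign 1 (Bin Add (Reg 8) (Const 1))) (Assign 0 (Const 0)))))
   + (1 + cost (Bin Less (Reg 7) (Reg 8)) + com_cost write_com)))))"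

text \<open>The contract between the array and the query program. Addresses and counters stay below
  \<open>8 * N + 8\<close>, so reduction modulo \<open>2 ^ w\<close> is harmless;
  \<open>2 \<le> N\<close> puts address 15 inside the array.\<close>

locale query_tables =
  fixes w n N Q K :: nat and D :: "nat list" and T d home :: "nat \<Rightarrow> nat"
    and S :: "nat \<Rightarrow> nat set" and par dep :: "nat \<Rightarrow> nat \<Rightarrow> nat" and E :: "nat rel"
  fixes pos :: "nat \<Rightarrow> nat \<Rightarrow> nat"
  defines "pos c v \<equiv> v + d ((c + T v) mod Q)"
  assumes sizes: "n \<ge> 1" "n \<le> N" "2 \<le> N" "Q > 0" "2 * Q \<le> N" "8 * N + 8 \<le> 2 ^ w" "length D = 8 * N"
    and params: "D ! 7 = n" "D ! 15 = Q"
    and T: "v < n \<Longrightarrow> D ! (8 * v) = T v" "T v < Q"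
    and d: "j < Q \<Longrightarrow> D ! (8 * j + 1) = d j" "n + d j \<le> N"
    and home: "i < K \<Longrightarrow> u < n \<Longrightarrow> D ! (8 * (i * n + u) + 2) = home (i * n + u)" "K * n \<le> N"
      "x < K * n \<Longrightarrow> home x < Q"
    and tree: "c < Q \<Longrightarrow> S c \<subseteq> {..<n}" "c < Q \<Longrightarrow> rooted_tree E (S c) (par c) (dep c)" "sym E"
    and node: "c < Q \<Longrightarrow> v \<in> S c \<Longrightarrow> D ! (8 * pos c v + 3) = Suc c"
      "c < Q \<Longrightarrow> v \<in> S c \<Longrightarrow> D ! (8 * pos c v + 4) = v"
      "c < Q \<Longrightarrow> v \<in> S c \<Longrightarrow> D ! (8 * pos c v + 5) = dep c v"
      "c < Q \<Longrightarrow> v \<in> S c \<Longrightarrow> dep c v > 0 \<Longrightarrow> D ! (8 * pos c v + 6) = pos c (par c v)"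
    and no_node: "c < Q \<Longrightarrow> v < n \<Longrightarrow> v \<notin> S c \<Longrightarrow>
      \<not> (D ! (8 * pos c v + 3) = Suc c \<and> D ! (8 * pos c v + 4) = v)"
    and pos_inj: "c < Q \<Longrightarrow> inj_on (pos c) (S c)"
begin

section \<open>Expression values and the three loops of the query\<close>

lemma mod_word [simp]: "x < 8 * N + 8 \<Longrightarrow> x mod 2 ^ w = x"
  using sizes(6) by simp

lemma lt_word: "x < 8 * N + 8 \<Longrightarrow> x < 2 ^ w"
  using sizes(6) by simp

lemma w_pos: "w > 0"
  using sizes(6) by (cases w) auto

lemma index_less: "i < K \<Longrightarrow> u < n \<Longrightarrow> i * n + u < K * n"
proof -
  assume "i < K" "u < n"
  then have "i * n + u < Suc i * n" "Suc i * n \<le> K * n" by (simp, intro mult_le_mono1) simp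
  then show ?thesis by (rule less_le_trans)
qed

lemma pos_less: "v < n \<Longrightarrow> pos c v < N"
  unfolding pos_def using d(2)[of "(c + T v) mod Q"] by linarith

lemma field_val: "expr_val w D s e = x \<Longrightarrow> x < N \<Longrightarrow> f < 8 \<Longrightarrow> expr_val w D s (field f e) = D ! (8 * x + f)"
  unfolding field_def by (simp add: sizes(7))

lemma hash_val:
  assumes "expr_val w D s ce = c" "expr_val w D s ve = v" "c < Q" "v < n"
  shows "expr_val w D s (hash_expr ce ve) = pos c v"
proof -
  have "expr_val w D s (field 0 ve) = T v"
    using assms sizes by (subst field_val[of _ _ v]) (auto simp: T)
  moreover have "expr_val w D s (Data (Const 15)) = Q" using sizes params by simp
  ultimately have *: "expr_val w D s (Bin Mod (Bin Add ce (field 0 ve)) (Data (Const 15))) = (c + T v) mod Q"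
    using assms T(2)[of v] sizes mod_less_divisor[OF sizes(4), of "c + T v"]
    by (simp del: mod_less_divisor)
  have "(c + T v) mod Q < Q" using sizes(4) by simp
  then have "expr_val w D s (field 1 (Bin Mod (Bin Add ce (field 0 ve)) (Data (Const 15)))) = d ((c + T v) mod Q)"
    using sizes(5) d(1)[of "(c + T v) mod Q"] by (subst field_val[OF *]) simp_all
  moreover have "pos c v < 8 * N + 8" using pos_less[OF assms(4), of c] by simp
  ultimately show ?thesis using assms unfolding hash_expr_def by (simp add: pos_def)
qed

lemma lookup_run:
  assumes "fst s 1 = v" "fst s 2 = i * n + u" "i < K" "u < n" "v < n"
  shows "run w D lookup_com s =
    ((fst s)(3 := home (i * n + u), 4 := pos (home (i * n + u)) v), snd s)"
proof -
  have x: "i * n + u < K * n" using assms by (intro index_less)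
  have 1: "expr_val w D s (field 2 (Reg 2)) = home (i * n + u)"
    using x home assms by (subst field_val[of _ _ "i * n + u"]) auto
  have 2: "expr_val w D ((fst s)(3 := home (i * n + u)), snd s) (hash_expr (Reg 3) (Reg 1)) =
      pos (home (i * n + u)) v"
    using assms home(3)[OF x] by (intro hash_val) auto
  show ?thesis unfolding lookup_com_def using 1 2 by simp
qed

text \<open>The record at the hashed position may belong to another key; comparing both stored
  components detects this.\<close>

lemma missing_val:
  assumes "fst s 1 = v" "fst s 3 = c" "fst s 4 = pos c v" "c < Q" "v < n"
  shows "expr_val w D s missing_expr = of_bool (v \<notin> S c)"
proof -
  have f: "expr_val w D s (field f (Reg 4)) = D ! (8 * pos c v + f)" if "f < 8" for f
    using assms pos_less that by (subst field_val[of _ _ "pos c v"]) auto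
  show ?thesis
    unfolding missing_expr_def
    using assms sizes f[of 3] f[of 4] node(1,2)[of c v] no_node[of c v] w_pos by auto
qed

text \<open>Induction on the number of scales still to be skipped. The \<open>+ 1\<close> pays for
  the final test, which ends the loop.\<close>

lemma exec_scan:
  assumes "fst s 0 = u" "fst s 1 = v" "fst s 2 = i * n + u" "fst s 3 = home (i * n + u)"
    "fst s 4 = pos (home (i * n + u)) v" "u < n" "v < n"
    "i \<le> i'" "i' < K" "v \<in> S (home (i' * n + u))"
    "\<And>l. i \<le> l \<Longrightarrow> l < i' \<Longrightarrow> v \<notin> S (home (l * n + u))"
  shows "\<exists>t s'. exec w D (While missing_expr next_com) s t s' \<and>
    t \<le> (i' - i + 1) * (1 + cost missing_expr + com_cost next_com) \<and>
    fst s' = (fst s)(2 := i' * n + u, 3 := home (i' * n + u), 4 := pos (home (i' * n + u)) v) \<and>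
    snd s' = snd s"
  using assms
proof (induction "i' - i" arbitrary: i s)
  case 0
  then have i: "i = i'" by simp
  have "home (i' * n + u) < Q"
    using 0 by (intro home(3) index_less)
  then have "expr_val w D s missing_expr = 0"
    using 0 i by (subst missing_val[of s v "home (i' * n + u)"]) auto
  from exec.WhileFalse[OF this, of next_com] show ?case using 0 i
    by (intro exI[of _ "1 + cost missing_expr"] exI[of _ s]) (auto simp: fun_eq_iff)
next
  case (Suc k)
  have i: "i < i'" using Suc.hyps(2) by simp
  have "home (i * n + u) < Q"
    using Suc.prems i by (intro home(3) index_less) auto
  then have m: "expr_val w D s missing_expr \<noteq> 0"
    using Suc.prems i by (subst missing_val[of s v "home (i * n + u)"]) auto
  let ?s = "run w D next_com s"
  have "Suc i < K" using i Suc.prems by simp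
  then have "Suc i * n + u < K * n"
    using Suc.prems by (intro index_less)
  then have add: "expr_val w D s (Bin Add (Reg 2) (Data (Const 7))) = Suc i * n + u"
    using Suc.prems home(2) sizes params by (simp add: algebra_simps)
  have s': "?s = ((fst s)(2 := Suc i * n + u, 3 := home (Suc i * n + u), 4 := pos (home (Suc i * n + u)) v), snd s)"
    unfolding next_com_def run.simps add
    by (subst lookup_run[of _ v "Suc i" u]) (use Suc.prems \<open>Suc i < K\<close> in \<open>auto simp: fun_eq_iff\<close>)
  obtain t1 where t1: "t1 \<le> com_cost next_com" "exec w D next_com s t1 ?s"
    using exec_run[of next_com w D s] by (auto simp: next_com_def lookup_com_def)
  define B where "B = 1 + cost missing_expr + com_cost next_com"
  have "\<exists>t s2. exec w D (While missing_expr next_com) ?s t s2 \<and> t \<le> (i' - Suc i + 1) * B \<and>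
      fst s2 = (fst ?s)(2 := i' * n + u, 3 := home (i' * n + u), 4 := pos (home (i' * n + u)) v) \<and>
      snd s2 = snd ?s"
    unfolding B_def by (rule Suc.hyps(1)) (use Suc.hyps(2) Suc.prems i s' in simp_all)
  then obtain t2 s2 where t2: "exec w D (While missing_expr next_com) ?s t2 s2"
    "t2 \<le> (i' - Suc i + 1) * B"
    "fst s2 = (fst ?s)(2 := i' * n + u, 3 := home (i' * n + u), 4 := pos (home (i' * n + u)) v)"
    "snd s2 = snd ?s" by blast
  have "1 + cost missing_expr + t1 + t2 \<le> B + (i' - Suc i + 1) * B"
    unfolding B_def using t1(1) t2(2) B_def by simp
  also have "\<dots> = (i' - i + 1) * B" using i by (simp add: Suc_diff_Suc flip: mult_Suc)
  finally have "1 + cost missing_expr + t1 + t2 \<le> (i' - i + 1) * (1 + cost missing_expr + com_cost next_com)"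
    unfolding B_def .
  moreover have "fst s2 = (fst s)(2 := i' * n + u, 3 := home (i' * n + u), 4 := pos (home (i' * n + u)) v)"
    "snd s2 = snd s" using t2(3,4) s' by (simp_all add: fun_eq_iff)
  ultimately show ?case using exec.WhileTrue[OF m t1(2) t2(1)] by blast
qed

lemma node_field_val:
  assumes "fst s r = pos c x" "c < Q" "x \<in> S c"
  shows "expr_val w D s (field 4 (Reg r)) = x" "expr_val w D s (field 5 (Reg r)) = dep c x"
    "dep c x > 0 \<Longrightarrow> expr_val w D s (field 6 (Reg r)) = pos c (par c x)"
proof -
  have "pos c x < N" using tree(1)[OF assms(2)] assms(3) pos_less by auto
  then have "expr_val w D s (field f (Reg r)) = D ! (8 * pos c x + f)" if "f < 8" for f
    using assms that by (intro field_val) auto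
  then show "expr_val w D s (field 4 (Reg r)) = x" "expr_val w D s (field 5 (Reg r)) = dep c x"
    "dep c x > 0 \<Longrightarrow> expr_val w D s (field 6 (Reg r)) = pos c (par c x)"
    using node(2-4)[OF assms(2,3)] by simp_all
qed

lemma pos_eq_iff: "c < Q \<Longrightarrow> a \<in> S c \<Longrightarrow> b \<in> S c \<Longrightarrow> pos c a = pos c b \<longleftrightarrow> a = b"
  using pos_inj by (metis inj_onD)

text \<open>Each \<open>left\<close> or \<open>right\<close> rule of \<open>tree_path\<close> is one
  iteration. Arbitrary start values \<open>l\<close> and \<open>r\<close> serve the induction, and
  the bounds by \<open>2 * n\<close> keep addresses and counters within a word.\<close>

lemma exec_climb:
  defines "e \<equiv> Bin Equal (Bin Equal (Reg 5) (Reg 6)) (Const 0)"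
  assumes "tree_path (par c) (dep c) a b xs z ys" "c < Q" "a \<in> S c" "b \<in> S c"
    "fst s 5 = pos c a" "fst s 6 = pos c b" "fst s 7 = l" "fst s 8 = r"
    "l + length xs \<le> 2 * n" "r + length ys \<le> 2 * n"
  shows "\<exists>t s'. exec w D (While e climb_com) s t s' \<and>
    t \<le> (length xs + length ys + 1) * (1 + cost e + com_cost climb_com) \<and>
    fst s' = (fst s)(5 := pos c z, 6 := pos c z, 7 := l + length xs, 8 := r + length ys) \<and>
    snd s' = (\<lambda>x. if l \<le> x \<and> x < l + length xs then xs ! (x - l) else snd s x)"
  using assms(2-)
proof (induction arbitrary: s l r)
  case (meet a)
  then have "expr_val w D s e = 0" unfolding e_def using w_pos by simp
  from exec.WhileFalse[OF this, of climb_com] show ?case using meet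
    by (intro exI[of _ "1 + cost e"] exI[of _ s]) (auto simp: fun_eq_iff)
next
  case (left a b xs z ys)
  define B where "B = 1 + cost e + com_cost climb_com"
  note par = rooted_tree_parent[OF tree(2)[OF \<open>c < Q\<close>] left.prems(2)
      rooted_tree_deeper[OF tree(2)[OF \<open>c < Q\<close>] left.prems(2,3) left.hyps(1,2)]]
  have e: "expr_val w D s e \<noteq> 0"
    unfolding e_def using w_pos left.prems left.hyps by (simp add: pos_eq_iff)
  note va = node_field_val[OF left.prems(4) left.prems(1,2)]
  note vb = node_field_val[OF left.prems(5) left.prems(1,3)]
  let ?s = "run w D climb_com s"
  have s': "?s = ((fst s)(5 := pos c (par c a), 7 := Suc l), (snd s)(l := a))"
  proof -
    have v6: "expr_val w D (fst s, (snd s)(l := a)) (field 6 (Reg 5)) = pos c (par c a)"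
      using node_field_val(3)[of "(fst s, (snd s)(l := a))" 5 c a] left.prems par(3) by simp
    show ?thesis
      unfolding climb_com_def using va vb left.prems left.hyps sizes v6 w_pos by (simp add: fun_eq_iff)
  qed
  obtain t1 where t1: "t1 \<le> com_cost climb_com" "exec w D climb_com s t1 ?s"
    using exec_run[of climb_com w D s] by (auto simp: climb_com_def)
  have "\<exists>t s'. exec w D (While e climb_com) ?s t s' \<and> t \<le> (length xs + length ys + 1) * B \<and>
    fst s' = (fst ?s)(5 := pos c z, 6 := pos c z, 7 := Suc l + length xs, 8 := r + length ys) \<and>
    snd s' = (\<lambda>x. if Suc l \<le> x \<and> x < Suc l + length xs then xs ! (x - Suc l) else snd ?s x)"
    unfolding B_def by (rule left.IH) (use left.prems par s' in simp_all)
  then obtain t2 s2 where t2: "exec w D (While e climb_com) ?s t2 s2"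
    "t2 \<le> (length xs + length ys + 1) * B"
    "fst s2 = (fst ?s)(5 := pos c z, 6 := pos c z, 7 := Suc l + length xs, 8 := r + length ys)"
    "snd s2 = (\<lambda>x. if Suc l \<le> x \<and> x < Suc l + length xs then xs ! (x - Suc l) else snd ?s x)"
    by blast
  have "1 + cost e + t1 + t2 \<le> (length (a # xs) + length ys + 1) * B"
    using t1(1) t2(2) unfolding B_def by simp
  moreover have "fst s2 = (fst s)(5 := pos c z, 6 := pos c z, 7 := l + length (a # xs), 8 := r + length ys)"
    using t2(3) s' by (simp add: fun_eq_iff)
  moreover have "snd s2 = (\<lambda>x. if l \<le> x \<and> x < l + length (a # xs) then (a # xs) ! (x - l) else snd s x)"
    unfolding t2(4) s' by (auto simp: fun_eq_iff nth_Cons')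
  ultimately show ?case using exec.WhileTrue[OF e t1(2) t2(1)] unfolding B_def by blast
next
  case (right a b xs z ys)
  define B where "B = 1 + cost e + com_cost climb_com"
  have "dep c b > 0" using right.hyps by simp
  note par = rooted_tree_parent[OF tree(2)[OF \<open>c < Q\<close>] right.prems(3) this]
  have e: "expr_val w D s e \<noteq> 0"
    unfolding e_def using w_pos right.prems right.hyps by (simp add: pos_eq_iff)
  note va = node_field_val[OF right.prems(4) right.prems(1,2)]
  note vb = node_field_val[OF right.prems(5) right.prems(1,3)]
  let ?s = "run w D climb_com s"
  have s': "?s = ((fst s)(6 := pos c (par c b), 8 := Suc r), snd s)"
    unfolding climb_com_def using va vb right.prems right.hyps sizes w_pos par(3)
    by (simp add: fun_eq_iff)
  obtain t1 where t1: "t1 \<le> com_cost climb_com" "exec w D climb_com s t1 ?s"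
    using exec_run[of climb_com w D s] by (auto simp: climb_com_def)
  have "\<exists>t s'. exec w D (While e climb_com) ?s t s' \<and> t \<le> (length xs + length ys + 1) * B \<and>
    fst s' = (fst ?s)(5 := pos c z, 6 := pos c z, 7 := l + length xs, 8 := Suc r + length ys) \<and>
    snd s' = (\<lambda>x. if l \<le> x \<and> x < l + length xs then xs ! (x - l) else snd ?s x)"
    unfolding B_def by (rule right.IH) (use right.prems par s' in simp_all)
  then obtain t2 s2 where t2: "exec w D (While e climb_com) ?s t2 s2"
    "t2 \<le> (length xs + length ys + 1) * B"
    "fst s2 = (fst ?s)(5 := pos c z, 6 := pos c z, 7 := l + length xs, 8 := Suc r + length ys)"
    "snd s2 = (\<lambda>x. if l \<le> x \<and> x < l + length xs then xs ! (x - l) else snd ?s x)"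
    by blast
  have "1 + cost e + t1 + t2 \<le> (length xs + length (b # ys) + 1) * B"
    using t1(1) t2(2) unfolding B_def by simp
  moreover have "fst s2 = (fst s)(5 := pos c z, 6 := pos c z, 7 := l + length xs, 8 := r + length (b # ys))"
    using t2(3) s' by (simp add: fun_eq_iff)
  moreover have "snd s2 = (\<lambda>x. if l \<le> x \<and> x < l + length xs then xs ! (x - l) else snd s x)"
    unfolding t2(4) s' by (simp add: fun_eq_iff)
  ultimately show ?case using exec.WhileTrue[OF e t1(2) t2(1)] unfolding B_def by blast
qed

text \<open>Register 7 stays at the index \<open>l\<close> of the meeting vertex while register 8
  descends to it from the last index, so the ascent from \<open>b\<close> lands in memory in
  reverse.\<close>

lemma exec_write:
  defines "e \<equiv> Bin Less (Reg 7) (Reg 8)"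
  assumes "climb (par c) b ys" "\<forall>y\<in>set ys. dep c y > 0" "c < Q" "b \<in> S c"
    "fst s 4 = pos c b" "fst s 7 = l" "fst s 8 = l + length ys" "l + length ys \<le> 2 * n"
  shows "\<exists>t s'. exec w D (While e write_com) s t s' \<and>
    t \<le> (length ys + 1) * (1 + cost e + com_cost write_com) \<and>
    fst s' 0 = fst s 0 \<and> fst s' 1 = fst s 1 \<and>
    snd s' = (\<lambda>x. if l < x \<and> x \<le> l + length ys then rev ys ! (x - l - 1) else snd s x)"
  using assms(2-)
proof (induction ys arbitrary: s b)
  case Nil
  then have "expr_val w D s e = 0" unfolding e_def by simp
  from exec.WhileFalse[OF this, of write_com] show ?case using Nil
    by (intro exI[of _ "1 + cost e"] exI[of _ s]) (auto simp: fun_eq_iff)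
next
  case (Cons y ys)
  define B where "B = 1 + cost e + com_cost write_com"
  have y: "y = b" "dep c b > 0" using Cons.prems by auto
  note par = rooted_tree_parent[OF tree(2)[OF \<open>c < Q\<close>] \<open>b \<in> S c\<close> y(2)]
  have e: "expr_val w D s e \<noteq> 0" unfolding e_def using w_pos Cons.prems by simp
  let ?s = "run w D write_com s"
  let ?m = "(snd s)(Suc (l + length ys) := b)"
  have s': "?s = ((fst s)(4 := pos c (par c b), 8 := l + length ys), ?m)"
  proof -
    have "expr_val w D (fst s, ?m) (field 6 (Reg 4)) = pos c (par c b)"
      using node_field_val(3)[of "(fst s, ?m)" 4 c b] Cons.prems y by simp
    \<comment> \<open>The wrap-around subtraction is exact because register 8 is positive.\<close>
    moreover have "(Suc (l + length ys) + 2 ^ w - Suc 0) mod 2 ^ w = l + length ys"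
      using Cons.prems(8) sizes lt_word[of "l + length ys"] by simp
    ultimately show ?thesis
      unfolding write_com_def
      using node_field_val(1)[of s 4 c b] Cons.prems sizes w_pos by (simp add: fun_eq_iff)
  qed
  obtain t1 where t1: "t1 \<le> com_cost write_com" "exec w D write_com s t1 ?s"
    using exec_run[of write_com w D s] by (auto simp: write_com_def)
  have "\<exists>t s'. exec w D (While e write_com) ?s t s' \<and> t \<le> (length ys + 1) * B \<and>
    fst s' 0 = fst ?s 0 \<and> fst s' 1 = fst ?s 1 \<and>
    snd s' = (\<lambda>x. if l < x \<and> x \<le> l + length ys then rev ys ! (x - l - 1) else snd ?s x)"
    unfolding B_def by (rule Cons.IH[of "par c b"]) (use Cons.prems par s' in simp_all)
  then obtain t2 s2 where t2: "exec w D (While e write_com) ?s t2 s2" "t2 \<le> (length ys + 1) * B"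
    "fst s2 0 = fst ?s 0" "fst s2 1 = fst ?s 1"
    "snd s2 = (\<lambda>x. if l < x \<and> x \<le> l + length ys then rev ys ! (x - l - 1) else snd ?s x)"
    by blast
  have "1 + cost e + t1 + t2 \<le> (length (y # ys) + 1) * B"
    using t1(1) t2(2) unfolding B_def by simp
  moreover have "fst s2 0 = fst s 0" "fst s2 1 = fst s 1" using t2(3,4) s' by simp_all
  moreover have "snd s2 = (\<lambda>x. if l < x \<and> x \<le> l + length (y # ys)
      then rev (y # ys) ! (x - l - 1) else snd s x)"
    unfolding t2(5) s' by (auto simp: fun_eq_iff nth_append y(1) less_Suc_eq le_Suc_eq)
  ultimately show ?case using exec.WhileTrue[OF e t1(2) t2(1)] unfolding B_def by blast
qed

text \<open>Chains the six stages: first lookup, scan, start of the climb, climb, meeting vertex,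
  second climb. The states after them are \<open>s1\<close> to \<open>s6\<close>.\<close>

lemma query_answers:
  assumes "u < n" "v < n" "i < K" "u \<in> S (home (i * n + u))" "v \<in> S (home (i * n + u))"
    "\<And>l. l < i \<Longrightarrow> v \<notin> S (home (l * n + u))"
  defines "c \<equiv> home (i * n + u)"
  shows "\<exists>p t. answers w query_com D u v p t \<and> tree_vpath E (S c) (dep c) u v p \<and>
    length p \<le> dep c u + dep c v + 1 \<and> t \<le> query_cost * (i + length p)"
proof -
  have c: "c < Q" unfolding c_def using assms by (intro home(3) index_less)
  have uS: "u \<in> S c" "v \<in> S c" unfolding c_def using assms by auto
  have "finite (S c)" "card (S c) \<le> n"
    using tree(1)[OF c] finite_subset card_mono[of "{..<n}" "S c"] by auto
  then have dep: "dep c u < n" "dep c v < n"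
    using uS rooted_tree_depth_less_card[OF tree(2)[OF c]] by (meson less_le_trans)+
  obtain xs z ys where path: "tree_path (par c) (dep c) u v xs z ys"
    using tree_path_exists[OF tree(2)[OF c] uS] by blast
  note vpath = tree_path_vpath[OF path tree(2)[OF c] tree(3) uS]
  note climb = tree_path_climb[OF path]
  have len: "length xs + length ys \<le> 2 * n" using vpath dep by linarith
  have z: "z \<in> S c" using vpath unfolding tree_vpath_def by simp
  have K: "0 < K" using assms(3) by simp

  define s0 where "s0 = init_state u v"
  let ?c1 = "Seq (Assign 2 (Reg 0)) lookup_com"
  define s1 where "s1 = run w D ?c1 s0"
  have s1: "s1 = ((fst s0)(2 := u, 3 := home u, 4 := pos (home u) v), \<lambda>_. 0)"
    unfolding s1_def s0_def init_state_def run.simps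
    by (subst lookup_run[of _ v 0 u]) (use assms K in \<open>auto simp: fun_eq_iff\<close>)
  obtain t1 where t1: "t1 \<le> com_cost ?c1" "exec w D ?c1 s0 t1 s1"
    using exec_run[of ?c1 w D s0] unfolding s1_def by (auto simp: lookup_com_def)

  define B2 where "B2 = 1 + cost missing_expr + com_cost next_com"
  have "\<exists>t s'. exec w D (While missing_expr next_com) s1 t s' \<and> t \<le> (i - 0 + 1) * B2 \<and>
    fst s' = (fst s1)(2 := i * n + u, 3 := home (i * n + u), 4 := pos (home (i * n + u)) v) \<and>
    snd s' = snd s1"
    unfolding B2_def
    by (rule exec_scan) (use assms in \<open>simp_all add: s1 s0_def init_state_def\<close>)
  then obtain t2 s2 where t2: "exec w D (While missing_expr next_com) s1 t2 s2" "t2 \<le> (i + 1) * B2"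
    "fst s2 = (fst s1)(2 := i * n + u, 3 := c, 4 := pos c v)" "snd s2 = snd s1"
    unfolding c_def by auto

  let ?c3 = "Seq (Assign 5 (hash_expr (Reg 3) (Reg 0))) (Assign 6 (Reg 4))"
  define s3 where "s3 = run w D ?c3 s2"
  have "expr_val w D s2 (hash_expr (Reg 3) (Reg 0)) = pos c u"
    by (rule hash_val) (use c assms t2(3) s1 in \<open>simp_all add: s0_def init_state_def\<close>)
  then have s3: "s3 = ((fst s2)(5 := pos c u, 6 := pos c v), \<lambda>_. 0)"
    unfolding s3_def using t2(3,4) s1 by (simp add: fun_eq_iff)
  obtain t3 where t3: "t3 \<le> com_cost ?c3" "exec w D ?c3 s2 t3 s3"
    using exec_run[of ?c3 w D s2] unfolding s3_def by auto

  let ?e4 = "Bin Equal (Bin Equal (Reg 5) (Reg 6)) (Const 0)"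
  define B4 where "B4 = 1 + cost ?e4 + com_cost climb_com"
  have mem4: "(\<lambda>x. if 0 \<le> x \<and> x < 0 + length xs then xs ! (x - 0) else snd s3 x) =
      (\<lambda>x. if x < length xs then xs ! x else 0)" by (simp add: s3 fun_eq_iff)
  have "\<exists>t s'. exec w D (While ?e4 climb_com) s3 t s' \<and> t \<le> (length xs + length ys + 1) * B4 \<and>
    fst s' = (fst s3)(5 := pos c z, 6 := pos c z, 7 := 0 + length xs, 8 := 0 + length ys) \<and>
    snd s' = (\<lambda>x. if 0 \<le> x \<and> x < 0 + length xs then xs ! (x - 0) else snd s3 x)"
    unfolding B4_def
    by (rule exec_climb[OF path c uS]) (use len t2 s1 in \<open>simp_all add: s3 s0_def init_state_def\<close>)
  then obtain t4 s4 where t4: "exec w D (While ?e4 climb_com) s3 t4 s4"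
    "t4 \<le> (length xs + length ys + 1) * B4"
    "fst s4 = (fst s3)(5 := pos c z, 6 := pos c z, 7 := length xs, 8 := length ys)"
    "snd s4 = (\<lambda>x. if x < length xs then xs ! x else 0)"
    unfolding mem4 by auto

  let ?c5 = "Seq (Store (Reg 7) (field 4 (Reg 5)))
         (Seq (Assign 8 (Bin Add (Reg 7) (Reg 8)))
         (Seq (Assign 1 (Bin Add (Reg 8) (Const 1))) (Assign 0 (Const 0))))"
  define s5 where "s5 = run w D ?c5 s4"
  have "expr_val w D s4 (field 4 (Reg 5)) = z"
    by (rule node_field_val(1)) (use c z t4(3) in auto)
  then have s5: "s5 = ((fst s4)(8 := length xs + length ys, 1 := length xs + length ys + 1, 0 := 0),
      (snd s4)(length xs := z))"
    unfolding s5_def using t4(3) len sizes w_pos by (simp add: fun_eq_iff)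
  obtain t5 where t5: "t5 \<le> com_cost ?c5" "exec w D ?c5 s4 t5 s5"
    using exec_run[of ?c5 w D s4] unfolding s5_def by auto

  let ?e6 = "Bin Less (Reg 7) (Reg 8)"
  define B6 where "B6 = 1 + cost ?e6 + com_cost write_com"
  have "\<exists>t s'. exec w D (While ?e6 write_com) s5 t s' \<and> t \<le> (length ys + 1) * B6 \<and>
    fst s' 0 = fst s5 0 \<and> fst s' 1 = fst s5 1 \<and>
    snd s' = (\<lambda>x. if length xs < x \<and> x \<le> length xs + length ys
      then rev ys ! (x - length xs - 1) else snd s5 x)"
    unfolding B6_def
    by (rule exec_write[of c v])
      (use climb c uS len t2(3) t4(3) in \<open>simp_all add: s5 s3\<close>)
  then obtain t6 s6 where t6: "exec w D (While ?e6 write_com) s5 t6 s6" "t6 \<le> (length ys + 1) * B6"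
    "fst s6 0 = 0" "fst s6 1 = length xs + length ys + 1"
    "snd s6 = (\<lambda>x. if length xs < x \<and> x \<le> length xs + length ys
      then rev ys ! (x - length xs - 1) else snd s5 x)"
    using s5 by auto

  define p where "p = xs @ z # rev ys"
  have lp: "length p = length xs + length ys + 1" unfolding p_def by simp
  have "reported_list s6 = p"
  proof (rule nth_equalityI)
    show "length (reported_list s6) = length p" unfolding reported_list_def t6 lp by simp
    fix x assume "x < length (reported_list s6)"
    then have x: "x \<le> length xs + length ys" unfolding reported_list_def t6 by simp
    have "reported_list s6 ! x = snd s6 (fst s6 0 + x)" if "x < fst s6 1"
      using that unfolding reported_list_def by simp
    then have "reported_list s6 ! x = snd s6 x" using x t6(3,4) by simp
    \<comment> \<open>The climb wrote \<open>xs\<close>, the fifth stage \<open>z\<close>, the last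
      loop \<open>rev ys\<close>.\<close>
    also have "\<dots> = p ! x"
      using x unfolding t6 s5 t4 p_def by (auto simp: nth_append nth_Cons')
    finally show "reported_list s6 ! x = p ! x" .
  qed
  moreover have "exec w D query_com s0 (t1 + (t2 + (t3 + (t4 + (t5 + t6))))) s6"
    unfolding query_com_def
    by (intro exec.Seq[OF t1(2)] exec.Seq[OF t2(1)] exec.Seq[OF t3(2)] exec.Seq[OF t4(1)]
      exec.Seq[OF t5(2)] t6(1))
  ultimately have "answers w query_com D u v p (t1 + (t2 + (t3 + (t4 + (t5 + t6)))))"
    unfolding answers_def s0_def by blast
  moreover have "t1 + (t2 + (t3 + (t4 + (t5 + t6)))) \<le> query_cost * (i + length p)"
  proof -
    \<comment> \<open>A common bound for the iteration counts of all loops; straight-line stages are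
      included because \<open>?m \<ge> 1\<close>.\<close>
    let ?m = "i + length p"
    have m: "?m \<ge> 1" "i + 1 \<le> ?m" "length xs + length ys + 1 \<le> ?m" "length ys + 1 \<le> ?m"
      using lp by auto
    have "t1 + (t2 + (t3 + (t4 + (t5 + t6)))) \<le> com_cost ?c1 * ?m + (B2 * ?m + (com_cost ?c3 * ?m +
        (B4 * ?m + (com_cost ?c5 * ?m + B6 * ?m))))"
    proof (intro add_mono)
      show "t1 \<le> com_cost ?c1 * ?m" using t1(1) m(1) by (metis mult.right_neutral mult_le_mono)
      show "t3 \<le> com_cost ?c3 * ?m" using t3(1) m(1) by (metis mult.right_neutral mult_le_mono)
      show "t5 \<le> com_cost ?c5 * ?m" using t5(1) m(1) by (metis mult.right_neutral mult_le_mono)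
      show "t2 \<le> B2 * ?m" using t2(2) m(2) by (metis le_trans mult.commute mult_le_mono2)
      show "t4 \<le> B4 * ?m" using t4(2) m(3) by (metis le_trans mult.commute mult_le_mono2)
      show "t6 \<le> B6 * ?m" using t6(2) m(4) by (metis le_trans mult.commute mult_le_mono2)
    qed
    also have "\<dots> = query_cost * ?m"
      unfolding query_cost_def B2_def B4_def B6_def by (simp only: distrib_right add.assoc)
    finally show ?thesis .
  qed
  moreover have "tree_vpath E (S c) (dep c) u v p" "length p \<le> dep c u + dep c v + 1"
    using vpath lp unfolding p_def by auto
  ultimately show ?thesis by blast
qed

end

section \<open>The oracle\<close>

lemma exists_record_array:
  fixes F :: "nat \<Rightarrow> nat \<Rightarrow> nat"
  obtains D where "length D = 8 * N" "\<And>x f. x < N \<Longrightarrow> f < 8 \<Longrightarrow> D ! (8 * x + f) = F f x"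
    "\<And>y. y \<in> set D \<Longrightarrow> \<exists>f x. y = F f x"
proof
  let ?D = "map (\<lambda>y. F (y mod 8) (y div 8)) [0..<8 * N]"
  show "length ?D = 8 * N" by simp
  show "?D ! (8 * x + f) = F f x" if "x < N" "f < 8" for x f
    using that by simp
  show "\<exists>f x. y = F f x" if "y \<in> set ?D" for y using that by auto
qed

text \<open>The covers of all \<open>K\<close> scales are concatenated, so that cluster indices are
  global and one hash table serves every scale.\<close>

lemma exists_cluster_family:
  fixes n K L :: nat and E :: "nat rel" and r :: "nat \<Rightarrow> nat"
  assumes "sym E" "E \<subseteq> {..<n} \<times> {..<n}" "n < 2 ^ L"
  obtains m and S :: "nat \<Rightarrow> nat set" and par :: "nat \<Rightarrow> nat \<Rightarrow> nat" and dep :: "nat \<Rightarrow> nat \<Rightarrow> nat"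
  where "m \<le> K * n" "(\<Sum>c<m. card (S c)) \<le> 2 * n * K"
    "\<And>c. c < m \<Longrightarrow> S c \<subseteq> {..<n}" "\<And>c. c < m \<Longrightarrow> rooted_tree E (S c) (par c) (dep c)"
    "\<And>i u. i < K \<Longrightarrow> u < n \<Longrightarrow>
      \<exists>c<m. hop_ball E (r i) u \<subseteq> S c \<and> (\<forall>x\<in>S c. dep c x \<le> 2 * L * r i)"
proof -
  have E: "Restr E {..<n} = E" using assms(2) by auto
  have "\<exists>Cs. length Cs \<le> n \<and> (\<Sum>C\<leftarrow>Cs. card (fst C)) \<le> 2 * n \<and>
      (\<forall>C\<in>set Cs. good_cluster E {..<n} (2 * L * r i) C) \<and>
      (\<forall>u\<in>{..<n}. \<exists>C\<in>set Cs. hop_ball E (r i) u \<subseteq> fst C)" for i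
    using sparse_cover[OF assms(1), of "{..<n}" L "r i"] assms(3) unfolding E by simp
  then obtain Cs where Cs: "\<And>i. length (Cs i) \<le> n" "\<And>i. (\<Sum>C\<leftarrow>Cs i. card (fst C)) \<le> 2 * n"
      "\<And>i C. C \<in> set (Cs i) \<Longrightarrow> good_cluster E {..<n} (2 * L * r i) C"
      "\<And>i u. u < n \<Longrightarrow> \<exists>C\<in>set (Cs i). hop_ball E (r i) u \<subseteq> fst C"
    by (metis lessThan_iff)
  define A where "A = concat (map Cs [0..<K])"
  show thesis
  proof (rule that[of "length A" "\<lambda>c. fst (A ! c)" "\<lambda>c. fst (snd (A ! c))" "\<lambda>c. snd (snd (A ! c))"])
    have "length A \<le> K * n" "(\<Sum>C\<leftarrow>A. card (fst C)) \<le> 2 * n * K" unfolding A_def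
    proof (induction K)
      case (Suc K)
      { case 1 show ?case using Suc Cs(1)[of K] by simp }
      { case 2 show ?case using Suc Cs(2)[of K] by simp }
    qed simp_all
    then show "length A \<le> K * n" "(\<Sum>c<length A. card (fst (A ! c))) \<le> 2 * n * K"
      by (simp_all add: sum_list_sum_nth atLeast0LessThan)
  next
    fix c assume "c < length A"
    then have "A ! c \<in> set A" by simp
    then obtain i where "A ! c \<in> set (Cs i)" unfolding A_def by auto
    from Cs(3)[OF this] show "fst (A ! c) \<subseteq> {..<n}"
      "rooted_tree E (fst (A ! c)) (fst (snd (A ! c))) (snd (snd (A ! c)))"
      unfolding good_cluster_def by (auto split: prod.splits)
  next
    fix i u assume "i < K" "u < n"
    then obtain C where C: "C \<in> set (Cs i)" "hop_ball E (r i) u \<subseteq> fst C" using Cs(4) by blast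
    then have "C \<in> set A" using \<open>i < K\<close> unfolding A_def by auto
    then obtain c where "c < length A" "A ! c = C" by (metis in_set_conv_nth)
    with C Cs(3)[OF C(1)] show "\<exists>c<length A. hop_ball E (r i) u \<subseteq> fst (A ! c) \<and>
        (\<forall>x\<in>fst (A ! c). snd (snd (A ! c)) x \<le> 2 * L * r i)"
      unfolding good_cluster_def by (intro exI[of _ c]) (auto split: prod.splits)
  qed
qed

text \<open>The query may stop at a scale \<open>i'\<close> before the given \<open>i\<close>. The
  failures before \<open>i'\<close> are recorded because they bound the distance from below, which
  later yields both stretch and time.\<close>

lemma exists_oracle_array:
  fixes n K L w :: nat and E :: "nat rel" and r :: "nat \<Rightarrow> nat"
  assumes "sym E" "E \<subseteq> {..<n} \<times> {..<n}" "n < 2 ^ L" "n \<ge> 1" "K \<ge> 1"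
  defines "N \<equiv> n + 4 * n * K + 1"
  assumes w: "8 * N + 8 \<le> 2 ^ w"
  obtains D where "length D = 8 * N" "\<And>x. x \<in> set D \<Longrightarrow> x < 2 ^ w"
    "\<And>u v i. u < n \<Longrightarrow> v < n \<Longrightarrow> i < K \<Longrightarrow> v \<in> hop_ball E (r i) u \<Longrightarrow>
      \<exists>p t i'. i' < K \<and> (\<forall>l<i'. v \<notin> hop_ball E (r l) u) \<and> answers w query_com D u v p t \<and>
        p \<noteq> [] \<and> hd p = u \<and> last p = v \<and> distinct p \<and> set p \<subseteq> {..<n} \<and> set (vwalk_arcs p) \<subseteq> E \<and>
        length p \<le> 4 * L * r i' + 1 \<and> t \<le> query_cost * (i' + length p)"
proof -
  obtain m S par dep where S: "m \<le> K * n" "(\<Sum>c<m. card (S c)) \<le> 2 * n * K"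
    "\<And>c. c < m \<Longrightarrow> S c \<subseteq> {..<n}" "\<And>c. c < m \<Longrightarrow> rooted_tree E (S c) (par c) (dep c)"
    "\<And>i u. i < K \<Longrightarrow> u < n \<Longrightarrow>
      \<exists>c<m. hop_ball E (r i) u \<subseteq> S c \<and> (\<forall>x\<in>S c. dep c x \<le> 2 * L * r i)"
    using exists_cluster_family[OF assms(1-3), of K r] by metis
  \<comment> \<open>This bounds the number of keys, the number of clusters and the number of home
    records. Positions are at most \<open>(n - 1) + 2 * Q\<close>, whence the value of
    \<open>N\<close>.\<close>
  define Q where "Q = 2 * n * K"
  have "K * n \<le> Q" unfolding Q_def by simp
  then have Q: "m \<le> Q" "K * n \<le> Q" using S(1) by (blast intro: le_trans)+
  have Q0: "Q > 0" unfolding Q_def using assms(4,5) by simp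
  have NQ: "N = n + 2 * Q + 1" unfolding N_def Q_def by simp
  define P where "P = Sigma {..<m} S"
  have P: "P \<subseteq> {..<Q} \<times> {..<n}" unfolding P_def using S(3) Q(1) by fastforce
  have "card P = (\<Sum>c<m. card (S c))"
    unfolding P_def using S(3) by (intro card_SigmaI) (auto intro: finite_subset)
  then have "card P \<le> Q" using S(2) unfolding Q_def by simp
  then obtain T d where Td: "\<And>v. T v < Q" "\<And>j. d j < 2 * Q + 1"
      "inj_on (\<lambda>(c, v). v + d ((c + T v) mod Q)) P"
    using exists_perfect_hash[OF P Q0] by blast
  define pos where "pos c v = v + d ((c + T v) mod Q)" for c v
  have inj: "inj_on (\<lambda>(c, v). pos c v) P" using Td(3) unfolding pos_def .
  define nd where "nd = inv_into P (\<lambda>(c, v). pos c v)"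
  have nd: "nd (pos c v) = (c, v)" if "(c, v) \<in> P" for c v
    unfolding nd_def using inv_into_f_f[OF inj that] by simp
  define occ where "occ p \<longleftrightarrow> p \<in> (\<lambda>(c, v). pos c v) ` P" for p
  have occ: "occ (pos c v)" if "(c, v) \<in> P" for c v using that unfolding occ_def by force
  have occ_nd: "nd p \<in> P" "pos (fst (nd p)) (snd (nd p)) = p" if "occ p" for p
    using that nd unfolding occ_def by auto
  have "\<exists>c<m. hop_ball E (r (x div n)) (x mod n) \<subseteq> S c \<and> (\<forall>y\<in>S c. dep c y \<le> 2 * L * r (x div n))"
    if "x < K * n" for x
    using that assms(4) by (intro S(5)) (auto simp: less_mult_imp_div_less)
  then obtain hm where hm: "\<And>x. x < K * n \<Longrightarrow> hm x < m \<and>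
      hop_ball E (r (x div n)) (x mod n) \<subseteq> S (hm x) \<and> (\<forall>y\<in>S (hm x). dep (hm x) y \<le> 2 * L * r (x div n))"
    by metis
  \<comment> \<open>Unoccupied records hold 0 in fields 3 to 6. The parent field of a root is 0, as
    \<open>par\<close> is unconstrained there and might not fit into a word.\<close>
  define F where "F f x = (if f = 0 then T x else if f = 1 then d x
      else if f = 2 then (if x < K * n then hm x else 0)
      else if f = 7 then (if x = 0 then n else Q)
      else if \<not> occ x then 0
      else case nd x of (c, v) \<Rightarrow> if f = 3 then Suc c else if f = 4 then v else if f = 5 then dep c v
        else if dep c v > 0 then pos c (par c v) else 0)" for f x :: nat
  obtain D where D: "length D = 8 * N" "\<And>x f. x < N \<Longrightarrow> f < 8 \<Longrightarrow> D ! (8 * x + f) = F f x"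
    "\<And>y. y \<in> set D \<Longrightarrow> \<exists>f x. y = F f x"
    using exists_record_array[of N F] by blast
  have posN: "pos c v < N" if "v < n" for c v
    using that Td(2)[of "(c + T v) mod Q"] unfolding pos_def NQ by linarith
  have dep_n: "dep c v < n" if "c < m" "v \<in> S c" for c v
    using rooted_tree_depth_less_card[OF S(4)[OF that(1)] _ that(2)] card_mono[OF _ S(3)[OF that(1)]]
      finite_subset[OF S(3)[OF that(1)]] by simp
  have F_le: "F f x \<le> N" for f x
  proof -
    have "F f x \<le> N" if "occ x" "nd x = (c, v)" "f \<notin> {0, 1, 2, 7}" for c v
    proof -
      have cv: "c < m" "v \<in> S c" using occ_nd(1)[OF that(1)] that(2) unfolding P_def by auto
      have "dep c v > 0 \<Longrightarrow> par c v < n" using rooted_tree_parent[OF S(4)[OF cv(1)] cv(2)] S(3)[OF cv(1)] by auto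
      then have "dep c v > 0 \<Longrightarrow> pos c (par c v) < N" using posN by blast
      moreover have "v < n" using cv S(3) by blast
      ultimately show ?thesis using that cv dep_n[OF cv] Q unfolding F_def NQ by auto
    qed
    moreover have "F f x \<le> N" if "f \<in> {0, 1, 2, 7} \<or> \<not> occ x"
      using that Td(1)[of x] Td(2)[of x] hm[of x] Q Q0 unfolding F_def NQ by auto
    ultimately show ?thesis by (cases "nd x") blast
  qed
  have node: "F 3 (pos c v) = Suc c" "F 4 (pos c v) = v" "F 5 (pos c v) = dep c v"
    "dep c v > 0 \<Longrightarrow> F 6 (pos c v) = pos c (par c v)" if "(c, v) \<in> P" for c v
    unfolding F_def using occ[OF that] nd[OF that] by simp_all
  \<comment> \<open>Cluster indices range over all of \<open>Q\<close> in the locale; those from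
    \<open>m\<close> on get an empty cluster.\<close>
  define S' where "S' c = (if c < m then S c else {})" for c
  have P_S': "(c, v) \<in> P \<longleftrightarrow> v \<in> S' c" for c v unfolding P_def S'_def by auto
  have S'_tree: "rooted_tree E (S' c) (par c) (dep c)" for c
    using S(4)[of c] unfolding S'_def by (auto simp: rooted_tree_def)
  have S'_n: "S' c \<subseteq> {..<n}" for c using S(3)[of c] unfolding S'_def by auto
  have no_node: "\<not> (F 3 (pos c v) = Suc c \<and> F 4 (pos c v) = v)" if "v \<notin> S' c" for c v
  proof
    assume *: "F 3 (pos c v) = Suc c \<and> F 4 (pos c v) = v"
    then have o: "occ (pos c v)" unfolding F_def by (auto split: if_splits)
    with * have "nd (pos c v) = (c, v)" unfolding F_def by (auto split: prod.splits)
    with occ_nd(1)[OF o] that show False by (simp add: P_S')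
  qed
  have divmod: "(i * n + u) div n = i" "(i * n + u) mod n = u" if "u < n" for i u
    using that by auto
  have index: "i * n + u < K * n" if "i < K" "u < n" for i u
  proof -
    have "i * n + u < Suc i * n" "Suc i * n \<le> K * n" using that by (simp, intro mult_le_mono1) simp
    then show ?thesis by (rule less_le_trans)
  qed
  interpret query_tables w n N Q K D T d hm S' par dep E pos
  proof (unfold_locales, unfold pos_def[symmetric])
    show "D ! 7 = n" "D ! 15 = Q" using D(2)[of 0 7] D(2)[of 1 7] Q0 unfolding NQ F_def by auto
    show "D ! (8 * v) = T v" if "v < n" for v using D(2)[of v 0] that unfolding NQ F_def by simp
    show "D ! (8 * j + 1) = d j" if "j < Q" for j using D(2)[of j 1] that unfolding NQ F_def by simp
    show "n + d j \<le> N" for j using Td(2)[of j] unfolding NQ by simp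
    show "D ! (8 * (i * n + u) + 2) = hm (i * n + u)" if "i < K" "u < n" for i u
      using D(2)[of "i * n + u" 2] index[OF that] Q(2) unfolding NQ F_def by simp
    show "hm x < Q" if "x < K * n" for x using hm[OF that] Q(1) by simp
    fix c v assume v: "v \<in> S' c"
    then have Pv: "(c, v) \<in> P" and p: "pos c v < N" using P_S' posN[of v c] S'_n[of c] by auto
    show "D ! (8 * pos c v + 3) = Suc c" "D ! (8 * pos c v + 4) = v" "D ! (8 * pos c v + 5) = dep c v"
      "dep c v > 0 \<Longrightarrow> D ! (8 * pos c v + 6) = pos c (par c v)"
      using D(2)[OF p] node[OF Pv] by simp_all
  next
    fix c v assume v: "v < n" "v \<notin> S' c"
    show "\<not> (D ! (8 * pos c v + 3) = Suc c \<and> D ! (8 * pos c v + 4) = v)"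
      using D(2)[OF posN[OF v(1)]] no_node[OF v(2)] by simp
  next
    fix c show "inj_on (pos c) (S' c)"
    proof (rule inj_onI)
      fix a b assume "a \<in> S' c" "b \<in> S' c" "pos c a = pos c b"
      then show "a = b" using inj_onD[OF inj, of "(c, a)" "(c, b)"] P_S' by auto
    qed
  qed (use assms(1,4) w Q Q0 D(1) Td(1) NQ S'_tree S'_n pos_def in auto)
  show thesis
  proof (rule that[OF D(1)])
    show "x < 2 ^ w" if xD: "x \<in> set D" for x
    proof -
      obtain f y where "x = F f y" using D(3)[OF xD] by blast
      with F_le[of f y] w show ?thesis by linarith
    qed
  next
    fix u v i
    assume u: "u < n" and v: "v < n" and i: "i < K" "v \<in> hop_ball E (r i) u"
    have hm': "hop_ball E (r i) u \<subseteq> S' (hm (i * n + u))"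
      "\<And>x. x \<in> S' (hm (i * n + u)) \<Longrightarrow> dep (hm (i * n + u)) x \<le> 2 * L * r i" if "i < K" for i
      using hm[OF index[OF that u]] unfolding divmod[OF u] S'_def by auto
    \<comment> \<open>A home cluster can exceed its ball, so the first success may come before scale
      \<open>i\<close>.\<close>
    define i' where "i' = (LEAST i. v \<in> S' (hm (i * n + u)))"
    have vi: "v \<in> S' (hm (i * n + u))" using hm'(1)[OF i(1)] i(2) by blast
    have vi': "v \<in> S' (hm (i' * n + u))" unfolding i'_def using vi by (rule LeastI)
    have "i' \<le> i" unfolding i'_def using vi by (rule Least_le)
    then have i': "i' < K" using i(1) by simp
    have less: "v \<notin> S' (hm (l * n + u))" if "l < i'" for l
      using that not_less_Least unfolding i'_def by blast
    have ui': "u \<in> S' (hm (i' * n + u))" using hm'(1)[OF i'] hop_ball_self[of u E "r i'"] by blast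
    obtain p t where p: "answers w query_com D u v p t"
      "tree_vpath E (S' (hm (i' * n + u))) (dep (hm (i' * n + u))) u v p"
      "length p \<le> dep (hm (i' * n + u)) u + dep (hm (i' * n + u)) v + 1"
      "t \<le> query_cost * (i' + length p)"
      using query_answers[OF u v i' ui' vi' less] by blast
    have "length p \<le> 4 * L * r i' + 1" using p(3) hm'(2)[OF i' ui'] hm'(2)[OF i' vi'] by simp
    moreover have "\<forall>l<i'. v \<notin> hop_ball E (r l) u"
    proof (intro allI impI)
      fix l assume "l < i'"
      then show "v \<notin> hop_ball E (r l) u" using less[of l] hm'(1)[of l] i' by auto
    qed
    moreover have "p \<noteq> []" "hd p = u" "last p = v" "distinct p" "set p \<subseteq> {..<n}" "set (vwalk_arcs p) \<subseteq> E"
      using p(2) S'_n unfolding tree_vpath_def by blast+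
    ultimately show "\<exists>p t i'. i' < K \<and> (\<forall>l<i'. v \<notin> hop_ball E (r l) u) \<and> answers w query_com D u v p t \<and>
        p \<noteq> [] \<and> hd p = u \<and> last p = v \<and> distinct p \<and> set p \<subseteq> {..<n} \<and> set (vwalk_arcs p) \<subseteq> E \<and>
        length p \<le> 4 * L * r i' + 1 \<and> t \<le> query_cost * (i' + length p)"
      using p(1,4) i' by blast
  qed
qed

section \<open>Walks, balls and hop distance\<close>

lemma walk_relpow:
  "p \<noteq> [] \<Longrightarrow> set (vwalk_arcs p) \<subseteq> E \<Longrightarrow> (hd p, last p) \<in> E ^^ (length p - 1)"
proof (induction p rule: vwalk_arcs.induct)
  case (3 x y xs)
  then have "(x, y) \<in> E" "(y, last (y # xs)) \<in> E ^^ length xs" by auto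
  then have "(x, last (y # xs)) \<in> E ^^ Suc (length xs)" by (rule relpow_Suc_I2)
  then show ?case by simp
qed auto

context pair_wf_digraph
begin

lemma awalk_relpow: "awalk u p v \<Longrightarrow> (u, v) \<in> parcs G ^^ length p"
proof (induction p arbitrary: u)
  case (Cons e p)
  then have "(u, snd e) \<in> parcs G" "awalk (snd e) p v" by (cases e; auto simp: awalk_Cons_iff)+
  with Cons.IH show ?case unfolding length_Cons by (blast intro: relpow_Suc_I2)
qed (simp add: awalk_Nil_iff)

text \<open>The distance is an infimum over walks, and a walk of length at most \<open>m\<close>
  would put \<open>v\<close> into the ball. The empty infimum covers infinite distance.\<close>

lemma hop_dist_gt:
  assumes "v \<notin> hop_ball (parcs G) m u"
  shows "ereal (real m + 1) \<le> hop_dist G u v"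
  unfolding hop_dist_def \<mu>_def
proof (rule INF_greatest)
  fix p assume "p \<in> {p. awalk u p v}"
  then have "(u, v) \<in> parcs G ^^ length p" using awalk_relpow by simp
  with assms have "length p > m" unfolding hop_ball_def by (auto simp: not_le[symmetric])
  moreover have "awalk_cost (\<lambda>_. 1) p = real (length p)"
    by (induction p) auto
  ultimately show "ereal (real m + 1) \<le> ereal (awalk_cost (\<lambda>_. 1) p)" by simp
qed

lemma hop_dist_nonneg: "0 \<le> hop_dist G u v"
  unfolding hop_dist_def \<mu>_def
proof (rule INF_greatest)
  fix p
  have "awalk_cost (\<lambda>_. 1) p = real (length p)" by (induction p) auto
  then show "0 \<le> ereal (awalk_cost (\<lambda>_. 1) p)" by simp
qed

end

text \<open>A simple path visits each vertex at most once, so radius \<open>m\<close> reaches the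
  whole component.\<close>

lemma (in pair_fin_digraph) reachable_hop_ball:
  assumes "u \<rightarrow>\<^sup>*\<^bsub>with_proj G\<^esub> v" "card (pverts G) \<le> m"
  shows "v \<in> hop_ball (parcs G) m u"
proof -
  obtain p where p: "apath u p v" using assms(1) reachable_apath by blast
  then have aw: "awalk u p v" and dist: "distinct (pawalk_verts u p)"
    unfolding apath_def by blast+
  moreover have "set (pawalk_verts u p) \<subseteq> pverts G" using aw by (rule awalkE)
  ultimately have "length (pawalk_verts u p) \<le> card (pverts G)"
    using pair_finite_verts by (metis card_mono distinct_card)
  then have "length p \<le> m" using assms(2) length_awalk_verts[of u p] by simp
  with awalk_relpow[OF aw] show ?thesis unfolding hop_ball_def by blast
qed

section \<open>Choice of the scales and logarithmic estimates\<close>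

lemma exists_scales:
  fixes n :: nat and a s :: real
  assumes "n \<ge> 1" "s > 0" "a = real n powr (1 / s)"
  obtains q I where "q \<ge> 2" "real q \<le> 1 + a" "n \<le> q ^ I" "I \<le> n" "real I \<le> s + 1"
proof -
  have a: "a \<ge> 1" unfolding assms(3) using assms(1,2) by (intro ge_one_powr_ge_zero) auto
  \<comment> \<open>A base of at least 2 makes the scales grow even if \<open>a = 1\<close>; the
    bound \<open>1 + a\<close> survives because \<open>a \<ge> 1\<close>.\<close>
  define q where "q = max 2 (nat \<lceil>a\<rceil>)"
  have q: "q \<ge> 2" "a \<le> real q" "real q \<le> 1 + a"
    using a unfolding q_def by (auto simp: max_def intro: order.trans[OF real_nat_ceiling_ge]) linarith+
  have "n \<le> 2 ^ n" by (simp add: less_imp_le)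
  also have "(2::nat) ^ n \<le> q ^ n" using q(1) by (intro power_mono) auto
  finally have n: "n \<le> q ^ n" .
  \<comment> \<open>Minimality will give \<open>I \<le> s + 1\<close>, while
    \<open>I \<le> n\<close> keeps the array polynomial in \<open>n\<close> however large
    \<open>s\<close> is.\<close>
  define I where "I = (LEAST i. n \<le> q ^ i)"
  have I: "n \<le> q ^ I" "I \<le> n" unfolding I_def using n by (auto intro: LeastI Least_le)
  have "real I \<le> s + 1"
  proof (cases I)
    case (Suc j)
    then have "\<not> n \<le> q ^ j" unfolding I_def by (metis lessI not_less_Least)
    then have j: "real q ^ j < real n" by (metis not_le of_nat_less_iff of_nat_power)
    moreover have "q ^ j \<ge> 1" using q(1) by simp
    ultimately have n1: "real n > 1" by (metis \<open>\<not> n \<le> q ^ j\<close> le_less_trans not_le of_nat_1 of_nat_less_iff)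
    \<comment> \<open>Since \<open>a\<close> is the \<open>s\<close>-th root of \<open>n\<close>,
      \<open>a ^ j < n\<close> forces \<open>j < s\<close>.\<close>
    have "real n powr (real j / s) = a ^ j"
      unfolding assms(3) using n1 by (simp add: powr_powr flip: powr_realpow)
    also have "\<dots> \<le> real q ^ j" using a q(2) by (intro power_mono) auto
    also note j
    finally have "real n powr (real j / s) < real n powr 1" using n1 by simp
    then have "real j / s < 1" using n1 by (simp only: powr_less_cancel_iff)
    then show ?thesis using Suc assms(2) by (simp add: field_simps)
  qed (use assms(2) in simp)
  with q I show thesis using that by blast
qed

text \<open>The inequality \<open>1 + x \<le> exp x\<close> at \<open>x = ln n / k\<close>,
  multiplied by \<open>k\<close>. It trades the logarithm from region growing for the stated
  factor.\<close>

lemma log_le_root: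
  fixes n k :: nat
  assumes "n \<ge> 1" "k \<ge> 1"
  shows "1 + ln (real n) \<le> real k * real n powr (1 / real k)"
proof -
  have "real k * (1 + ln (real n) / real k) \<le> real k * exp (ln (real n) / real k)"
    by (intro mult_left_mono exp_ge_add_one_self) simp
  moreover have "real n powr (1 / real k) = exp (ln (real n) / real k)"
    using assms by (simp add: powr_def)
  ultimately show ?thesis using assms by (simp add: algebra_simps)
qed

lemma exists_log_bound:
  fixes n :: nat
  assumes "n \<ge> 1"
  obtains L where "n < 2 ^ L" "real L \<le> 2 * (1 + ln (real n))"
proof -
  define L where "L = (LEAST l. n < 2 ^ l)"
  have L: "n < 2 ^ L" unfolding L_def by (rule LeastI[of _ n]) (rule less_exp)
  then have "L \<noteq> 0" using assms by (intro notI) simp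
  then have "\<not> n < 2 ^ (L - 1)" unfolding L_def by (intro not_less_Least) (simp add: L_def)
  then have "ln (2 ^ (L - 1)) \<le> ln (real n)"
    using assms by (subst ln_le_cancel_iff) (simp_all add: not_less flip: of_nat_power_le_of_nat_cancel_iff)
  then have "real (L - 1) * ln 2 \<le> ln (real n)" by (simp add: ln_realpow)
  \<comment> \<open>The bound \<open>ln x \<le> x - 1\<close> at \<open>x = 1 / 2\<close> says that
    \<open>ln 2 \<ge> 1 / 2\<close>.\<close>
  moreover have "real (L - 1) * (1 / 2) \<le> real (L - 1) * ln 2"
    using ln_le_minus_one[of "1 / 2 :: real"] by (intro mult_left_mono) (simp_all add: ln_div)
  ultimately have "real L \<le> 2 * (1 + ln (real n))" using \<open>L \<noteq> 0\<close> by (simp add: of_nat_diff)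
  with L show thesis using that by blast
qed

lemma word_bits_power: "(real n + 1) ^ b \<le> 2 ^ word_bits b n"
proof -
  have "real n + 1 = 2 powr log 2 (real n + 1)" by simp
  also have "\<dots> \<le> 2 powr real (nat \<lceil>log 2 (real n + 1)\<rceil>)"
    by (intro powr_mono) (auto intro: real_nat_ceiling_ge)
  also have "\<dots> = 2 ^ nat \<lceil>log 2 (real n + 1)\<rceil>" by (rule powr_realpow) simp
  finally have "(real n + 1) ^ b \<le> (2 ^ nat \<lceil>log 2 (real n + 1)\<rceil>) ^ b"
    by (intro power_mono) auto
  then show ?thesis unfolding word_bits_def by (simp add: mult.commute flip: power_mult)
qed

text \<open>One program and one set of constants serve all graphs and parameters. The maximum in the
  space bound equals \<open>k * n / \<epsilon>\<close> whenever
  \<open>\<epsilon> \<le> k\<close>.\<close>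

theorem theorem4:
  shows "\<exists>(query :: com) (b :: nat) (C_space :: real) (C_stretch :: real) (C_time :: real).
    b \<ge> 1 \<and>
    (\<forall>(n :: nat) (G :: nat pair_pre_digraph) (k :: nat) (\<epsilon> :: real).
      pair_graph G \<and> pverts G = {..<n} \<and> k \<ge> 1 \<and> \<epsilon> > 0 \<longrightarrow>
      (\<exists>D :: nat list.
        path_reporting_oracle (word_bits b n) query D G
          (C_stretch * (real k * real n powr (1 / real k) * (real k + real n powr (\<epsilon> / real k)))) \<and>
        real (length D) \<le> C_space * max (real k * real n / \<epsilon>) (real n) \<and>
        query_time_per_length (word_bits b n) query D G C_time))"
proof -
  have "\<exists>D :: nat list.
        path_reporting_oracle (word_bits 8 n) query_com D G
          (8 * (real k * real n powr (1 / real k) * (real k + real n powr (\<epsilon> / real k)))) \<and>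
        real (length D) \<le> 144 * max (real k * real n / \<epsilon>) (real n) \<and>
        query_time_per_length (word_bits 8 n) query_com D G (2 * real query_cost)"
    if "pair_graph G" and verts: "pverts G = {..<n}" and k: "k \<ge> 1" and \<epsilon>: "\<epsilon> > 0"
    for n G k \<epsilon>
  proof (cases "n = 0")
    case True
    then show ?thesis using verts
      by (intro exI[of _ "[]"]) (simp add: path_reporting_oracle_def query_time_per_length_def)
  next
    case False
    then have n: "n \<ge> 1" by simp
    interpret pair_graph G by fact
    define E where "E = parcs G"
    have symE: "sym E" using pair_sym_arcs unfolding symmetric_def E_def by simp
    have E: "E \<subseteq> {..<n} \<times> {..<n}" using wellformed' verts unfolding E_def by auto
    define a where "a = real n powr (\<epsilon> / real k)"
    define s where "s = real k / \<epsilon>"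
    have s: "s > 0" "a = real n powr (1 / s)" unfolding s_def a_def using k \<epsilon> by auto
    obtain q I where q: "q \<ge> 2" "real q \<le> 1 + a" "n \<le> q ^ I" "I \<le> n" "real I \<le> s + 1"
      using exists_scales[OF n s] by blast
    obtain L where L: "n < 2 ^ L" "real L \<le> 2 * (1 + ln (real n))" using exists_log_bound[OF n] by blast
    define N where "N = n + 4 * n * Suc I + 1"
    \<comment> \<open>Since \<open>I \<le> n\<close>, \<open>N\<close> is at most quadratic in
      \<open>n\<close>; the eighth power of \<open>n + 1 \<ge> 2\<close> absorbs the
      constants.\<close>
    have bits: "8 * N + 8 \<le> 2 ^ word_bits 8 n"
    proof -
      define m where "m = n + 1"
      have "4 * n * Suc I \<le> 4 * n * m" using q(4) unfolding m_def by (intro mult_left_mono) auto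
      then have "8 * N + 8 \<le> 8 * (m + 4 * n * m) + 8" unfolding N_def m_def by simp
      also have "\<dots> \<le> 32 * m\<^sup>2" using n unfolding m_def by (simp add: power2_eq_square algebra_simps)
      also have "\<dots> \<le> m ^ 6 * m\<^sup>2"
      proof (rule mult_right_mono)
        have "(2::nat) ^ 6 \<le> m ^ 6" using n unfolding m_def by (intro power_mono) auto
        then show "32 \<le> m ^ 6" by simp
      qed simp
      also have "\<dots> = m ^ 8" by (simp flip: power_add)
      finally have "real (8 * N + 8) \<le> (real n + 1) ^ 8"
        unfolding m_def by (metis of_nat_1 of_nat_add of_nat_le_iff of_nat_power)
      also have "\<dots> \<le> 2 ^ word_bits 8 n" by (rule word_bits_power)
      finally show ?thesis by (metis of_nat_le_iff of_nat_numeral of_nat_power)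
    qed
    obtain D where D: "length D = 8 * N" "\<And>x. x \<in> set D \<Longrightarrow> x < 2 ^ word_bits 8 n"
      "\<And>u v i. u < n \<Longrightarrow> v < n \<Longrightarrow> i < Suc I \<Longrightarrow> v \<in> hop_ball E (q ^ i) u \<Longrightarrow>
      \<exists>p t i'. i' < Suc I \<and> (\<forall>l<i'. v \<notin> hop_ball E (q ^ l) u) \<and>
        answers (word_bits 8 n) query_com D u v p t \<and>
        p \<noteq> [] \<and> hd p = u \<and> last p = v \<and> distinct p \<and> set p \<subseteq> {..<n} \<and> set (vwalk_arcs p) \<subseteq> E \<and>
        length p \<le> 4 * L * q ^ i' + 1 \<and> t \<le> query_cost * (i' + length p)"
      using exists_oracle_array[OF symE E L(1) n, of "Suc I" "word_bits 8 n" "\<lambda>i. q ^ i"] bits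
      unfolding N_def by (metis Suc_le_mono le0 One_nat_def)
    let ?\<delta> = "8 * (real k * real n powr (1 / real k) * (real k + a))"
    \<comment> \<open>The constant 8 is 4 times the 2 in the bound on \<open>L\<close>; moreover
      \<open>q \<le> 1 + a \<le> k + a\<close>.\<close>
    have \<delta>: "4 * real L * real q \<le> ?\<delta>"
    proof -
      have "4 * real L * real q \<le> 8 * (1 + ln (real n)) * (real k + a)"
        by (rule mult_mono) (use L(2) q(2) k n in auto)
      also have "\<dots> \<le> 8 * (real k * real n powr (1 / real k)) * (real k + a)"
        using log_le_root[OF n k] unfolding a_def by (intro mult_right_mono) auto
      finally show ?thesis by simp
    qed
    have \<delta>0: "?\<delta> \<ge> 0" unfolding a_def by simp
    have query: "\<exists>p t. answers (word_bits 8 n) query_com D u v p t \<and> vpath p (with_proj G) \<and>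
        hd p = u \<and> last p = v \<and> ereal (real (vwalk_length p)) \<le> ereal ?\<delta> * hop_dist G u v \<and>
        real t \<le> 2 * real query_cost * (real (vwalk_length p) + 1)"
      if u: "u < n" and v: "v < n" and uv: "u \<rightarrow>\<^sup>*\<^bsub>with_proj G\<^esub> v" for u v
    proof -
      \<comment> \<open>The last scale has radius at least \<open>n\<close>, so the scan succeeds
        there at the latest.\<close>
      have "v \<in> hop_ball E (q ^ I) u"
        unfolding E_def using reachable_hop_ball[OF uv] q(3) verts by simp
      then obtain p t i where p: "\<forall>l<i. v \<notin> hop_ball E (q ^ l) u"
        "answers (word_bits 8 n) query_com D u v p t" "p \<noteq> []" "hd p = u" "last p = v" "distinct p"
        "set p \<subseteq> {..<n}" "set (vwalk_arcs p) \<subseteq> E" "length p \<le> 4 * L * q ^ i + 1"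
        "t \<le> query_cost * (i + length p)"
        using D(3)[OF u v lessI[of I]] by blast
      have path: "vpath p (with_proj G)" 
        using p(3,6-8) verts unfolding vpath_def vwalk_def E_def by simp
      have stretch: "ereal (real (vwalk_length p)) \<le> ereal ?\<delta> * hop_dist G u v"
      proof (cases "u = v")
        case True
        then have "length p = 1" using p(3-6) by (cases p) (auto split: if_splits)
        then have "vwalk_length p = 0" by simp
        moreover have "0 \<le> ereal ?\<delta> * hop_dist G u v"
          using \<delta>0 hop_dist_nonneg by (intro ereal_0_le_mult) simp_all
        ultimately show ?thesis by (simp only: of_nat_0 zero_ereal_def[symmetric])
      next
        case False
        \<comment> \<open>Success at scale 0 leaves the trivial bound 1 for distinct vertices;
          otherwise the failure at the scale before gives \<open>h = q ^ (i - 1)\<close>.\<close>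
        have "\<exists>h::nat. q ^ i \<le> q * h \<and> ereal (real h) \<le> hop_dist G u v"
        proof (cases i)
          case 0
          have "v \<notin> hop_ball (parcs G) 0 u" using False unfolding hop_ball_def by simp
          from hop_dist_gt[OF this] 0 q(1) show ?thesis by (intro exI[of _ 1]) simp
        next
          case (Suc j)
          then have "v \<notin> hop_ball (parcs G) (q ^ j) u" using p(1) unfolding E_def by simp
          from hop_dist_gt[OF this] have "ereal (real (q ^ j)) \<le> hop_dist G u v"
            by (rule order_trans[rotated]) simp
          then show ?thesis using Suc by (intro exI[of _ "q ^ j"]) simp
        qed
        then obtain h where h: "q ^ i \<le> q * h" "ereal (real h) \<le> hop_dist G u v" by blast
        have "vwalk_length p \<le> 4 * L * q ^ i" using p(9) by simp
        also have "\<dots> \<le> 4 * L * (q * h)" using h(1) by (rule mult_le_mono2)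
        finally have "real (vwalk_length p) \<le> real (4 * L * (q * h))"
          by (rule of_nat_mono)
        also have "\<dots> = 4 * real L * real q * real h" by simp
        also have "\<dots> \<le> ?\<delta> * real h" using \<delta> by (rule mult_right_mono) simp
        finally have "ereal (real (vwalk_length p)) \<le> ereal ?\<delta> * ereal (real h)" by simp
        also have "\<dots> \<le> ereal ?\<delta> * hop_dist G u v" using h(2) \<delta>0 by (intro ereal_mult_left_mono) auto
        finally show ?thesis .
      qed
      \<comment> \<open>The failed scale \<open>i - 1\<close> forces a path longer than
        \<open>q ^ (i - 1)\<close>, hence longer than \<open>i - 1\<close>, so the path pays for the
        scan.\<close>
      have "i \<le> length p"
      proof (cases i)
        case (Suc j)
        then have "v \<notin> hop_ball E (q ^ j) u" using p(1) by simp
        moreover have "(u, v) \<in> E ^^ (length p - 1)" using walk_relpow[OF p(3,8)] p(4,5) by simp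
        ultimately have "q ^ j < length p - 1" unfolding hop_ball_def by (auto simp: not_le[symmetric])
        moreover have "j < q ^ j" using q(1) by (intro power_gt_expt) auto
        ultimately show ?thesis using Suc by simp
      qed simp
      then have "query_cost * (i + length p) \<le> query_cost * (2 * length p)"
        by (intro mult_le_mono2) simp
      with p(10) have "t \<le> query_cost * (2 * length p)" by (rule le_trans)
      then have "real t \<le> real (query_cost * (2 * length p))" by (rule of_nat_mono)
      also have "\<dots> = 2 * real query_cost * (real (vwalk_length p) + 1)"
        using p(3) by (cases p) (simp_all add: algebra_simps)
      finally show ?thesis using p(2,4,5) path stretch by blast
    qed
    show ?thesis
    proof (intro exI[of _ D] conjI)
      show "path_reporting_oracle (word_bits 8 n) query_com D G
          (8 * (real k * real n powr (1 / real k) * (real k + real n powr (\<epsilon> / real k))))"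
        unfolding path_reporting_oracle_def verts a_def[symmetric] using D(2) query by blast
      show "query_time_per_length (word_bits 8 n) query_com D G (2 * real query_cost)"
        unfolding query_time_per_length_def verts
      proof (intro ballI allI impI)
        fix u v p t
        assume "u \<in> {..<n}" "v \<in> {..<n}" "u \<rightarrow>\<^sup>*\<^bsub>with_proj G\<^esub> v"
          and pt: "answers (word_bits 8 n) query_com D u v p t"
        then obtain p' t' where pt': "answers (word_bits 8 n) query_com D u v p' t'"
          "real t' \<le> 2 * real query_cost * (real (vwalk_length p') + 1)" using query by blast
        \<comment> \<open>The time bound concerns every halting run, and determinism leaves only
          one.\<close>
        have "t' = t \<and> p' = p"
          using pt pt'(1) exec_deterministic unfolding answers_def by blast
        with pt'(2) show "real t \<le> 2 * real query_cost * (real (vwalk_length p) + 1)" by simp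
      qed
      have "real (length D) \<le> 48 * (real n * (real I + 1))"
      proof -
        \<comment> \<open>Both \<open>n\<close> and 1 are at most \<open>n * Suc I\<close>, and 48
          is \<open>8 * (1 + 4 + 1)\<close>.\<close>
        have "length D \<le> 48 * (n * Suc I)" using n unfolding D(1) N_def by simp
        then have "real (length D) \<le> real (48 * (n * Suc I))" by (rule of_nat_mono)
        then show ?thesis by (simp add: algebra_simps)
      qed
      also have "\<dots> \<le> 48 * (real n * (s + 2))" using q(5) by (intro mult_left_mono) auto
      also have "\<dots> = 48 * (real k * real n / \<epsilon>) + 96 * real n"
        unfolding s_def by (simp add: algebra_simps)
      also have "\<dots> \<le> 144 * max (real k * real n / \<epsilon>) (real n)" by simp
      finally show "real (length D) \<le> 144 * max (real k * real n / \<epsilon>) (real n)" .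
    qed
  qed
  then show ?thesis
    by (intro exI[of _ query_com] exI[of _ 8] exI[of _ 144] exI[of _ 8] exI[of _ "2 * real query_cost"])
      auto
qed

end
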